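(* Let $L$ be a non-split link with $k$ components, and suppose $L=\hat\beta$ is the closure of a positive reduced braid $\beta$ with $c$ crossings. Then $$\min\deg V(L)\;\ge\;\frac c4-\frac{k-1}{2}\;\ge\;\frac{c(L)}{4}-\frac{k-1}{2},$$ and $\min\mathrm{cf}\,V(L)=(-1)^{k-1}$.
   Context: A positive braid is a word in the Artin generators $\sigma_i$ with only positive exponents (so all crossings of its closure are positive); it is reduced if its closed braid diagram is reduced, i.e. has no reducible crossing, a crossing being reducible if smoothing it out (according to orientation) yields a split (disconnected) diagram. $c(L)$ is the crossing number of $L$. $V(L)$ is the Jones polynomial with $t^{-1}V(L_+)-tV(L_-)=(t^{1/2}-t^{-1/2})V(L_0)$, $V(\text{unknot})=1$ (so the positive trefoil has $V=t+t^3-t^4$). $\min\deg V(L)$ is the lowest exponent of $t$ occurring in $V(L)$ and $\min\mathrm{cf}\,V(L)$ is the coefficient of that lowest-degree term. *)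

theory Defs
  imports Complex_Main "HOL-Library.Poly_Mapping"
begin

section \<open>Oriented link diagrams\<close>

text \<open>
  An oriented link diagram in the plane is put in Morse position with respect to the height
  function and read from bottom to top.  It becomes a word whose letters are a local minimum
  (\<open>Cup\<close>), a local maximum (\<open>Cap\<close>) or a crossing (\<open>Cross\<close>), all other strands running vertically.
  Positions on a horizontal line are counted from the left, starting with \<open>0\<close>.

  \<^item> \<open>Cup k b\<close> creates two strands at the positions \<open>k\<close> and \<open>k + 1\<close>; \<open>b\<close> says that the left one is
    oriented upwards (and then the right one is oriented downwards).
  \<^item> \<open>Cap k\<close> joins the strands at the positions \<open>k\<close> and \<open>k + 1\<close>.
  \<^item> \<open>Cross p k\<close> crosses the strands at the positions \<open>k\<close> and \<open>k + 1\<close>.  If \<open>p\<close> holds, the strand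
    running from bottom left to top right is the upper one, otherwise the other strand is.
    Hence for two strands oriented upwards, \<open>p\<close> says that the crossing is positive.
\<close>

datatype piece = Cup nat bool | Cap nat | Cross bool nat

fun pos :: "piece \<Rightarrow> nat" where
  "pos (Cup k b) = k"
| "pos (Cap k) = k"
| "pos (Cross p k) = k"

fun shift :: "nat \<Rightarrow> piece \<Rightarrow> piece" where
  "shift j (Cup k b) = Cup j b"
| "shift j (Cap k) = Cap j"
| "shift j (Cross p k) = Cross p j"

fun width_in :: "piece \<Rightarrow> nat" where
  "width_in (Cup k b) = 0"
| "width_in (Cap k) = 2"
| "width_in (Cross p k) = 2"

fun width_out :: "piece \<Rightarrow> nat" where
  "width_out (Cup k b) = 2"
| "width_out (Cap k) = 0"
| "width_out (Cross p k) = 2"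

text \<open>
  The strands met by a horizontal line are recorded as the list of their orientations
  (\<open>True\<close> for upwards).  The value \<open>None\<close> means that the letter cannot be attached on top.
\<close>

fun attach :: "piece \<Rightarrow> bool list \<Rightarrow> bool list option" where
  "attach (Cup k b) s =
     (if k \<le> length s then Some (take k s @ [b, \<not> b] @ drop k s) else None)"
| "attach (Cap k) s =
     (if k + 1 < length s \<and> s ! k \<noteq> s ! (k + 1) then Some (take k s @ drop (k + 2) s) else None)"
| "attach (Cross p k) s =
     (if k + 1 < length s then Some (take k s @ [s ! (k + 1), s ! k] @ drop (k + 2) s) else None)"

fun strands :: "piece list \<Rightarrow> bool list \<Rightarrow> bool list option" where
  "strands [] s = Some s"
| "strands (x # w) s = Option.bind (attach x s) (strands w)"

text \<open>The empty link is not admitted.\<close>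

definition is_diagram :: "piece list \<Rightarrow> bool" where
  "is_diagram w \<longleftrightarrow> w \<noteq> [] \<and> strands w [] = Some []"

definition num_crossings :: "piece list \<Rightarrow> nat" where
  "num_crossings w = length (filter (\<lambda>x. \<exists>p k. x = Cross p k) w)"


section \<open>Components and connectedness of a diagram\<close>

text \<open>
  The point \<open>(m, j)\<close> is the intersection of the diagram with the horizontal line between the
  letters \<open>w ! (m - 1)\<close> and \<open>w ! m\<close> at position \<open>j\<close>.
\<close>

definition points :: "piece list \<Rightarrow> (nat \<times> nat) set" where
  "points w = {(m, j). m \<le> length w \<and> j < length (the (strands (take m w) []))}"

text \<open>Two points that bound the same arc of a strand in one letter of the diagram:\<close>

inductive arc :: "piece list \<Rightarrow> nat \<times> nat \<Rightarrow> nat \<times> nat \<Rightarrow> bool" for w where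
  left: "\<lbrakk>m < length w; j < pos (w ! m)\<rbrakk> \<Longrightarrow> arc w (m, j) (m + 1, j)"
| right: "\<lbrakk>m < length w; pos (w ! m) \<le> j\<rbrakk>
    \<Longrightarrow> arc w (m, j + width_in (w ! m)) (m + 1, j + width_out (w ! m))"
| cup: "\<lbrakk>m < length w; w ! m = Cup k b\<rbrakk> \<Longrightarrow> arc w (m + 1, k) (m + 1, k + 1)"
| cap: "\<lbrakk>m < length w; w ! m = Cap k\<rbrakk> \<Longrightarrow> arc w (m, k) (m, k + 1)"
| rising: "\<lbrakk>m < length w; w ! m = Cross p k\<rbrakk> \<Longrightarrow> arc w (m, k) (m + 1, k + 1)"
| falling: "\<lbrakk>m < length w; w ! m = Cross p k\<rbrakk> \<Longrightarrow> arc w (m, k + 1) (m + 1, k)"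

text \<open>The two strands of a crossing meet in the projection:\<close>

inductive meet :: "piece list \<Rightarrow> nat \<times> nat \<Rightarrow> nat \<times> nat \<Rightarrow> bool" for w where
  "\<lbrakk>m < length w; w ! m = Cross p k\<rbrakk> \<Longrightarrow> meet w (m, k) (m, k + 1)"

definition same_component :: "piece list \<Rightarrow> ((nat \<times> nat) \<times> (nat \<times> nat)) set" where
  "same_component w = {(x, y). x \<in> points w \<and> y \<in> points w \<and> equivclp (arc w) x y}"

definition num_components :: "piece list \<Rightarrow> nat" where
  "num_components w = card (points w // same_component w)"

definition connected_diagram :: "piece list \<Rightarrow> bool" where
  "connected_diagram w \<longleftrightarrow>
     (\<forall>x\<in>points w. \<forall>y\<in>points w. equivclp (sup (arc w) (meet w)) x y)"


section \<open>Links\<close>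

text \<open>
  Links are diagrams modulo planar isotopy and the Reidemeister moves.  For diagrams in Morse
  position planar isotopy is generated by exchanging the heights of distant letters (\<open>far\<close>),
  by cancelling a minimum against an adjacent maximum (\<open>zigzag\<close>) and by moving a strand past a
  minimum or a maximum (\<open>slide\<close>).  The moves do not mention the orientations of the strands, since
  they are only applied when both sides are diagrams.
\<close>

inductive local_move :: "piece list \<Rightarrow> piece list \<Rightarrow> bool" where
  far: "pos x + width_in x \<le> pos y
    \<Longrightarrow> local_move [y, x] [x, shift (pos y - width_in x + width_out x) y]"
| zigzag1: "local_move [Cup k b, Cap (k + 1)] []"
| zigzag2: "local_move [Cup (k + 1) b, Cap k] []"
| slide_cup: "local_move [Cup k b, Cross p (k + 1)] [Cup (k + 1) b, Cross (\<not> p) k]"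
| slide_cap: "local_move [Cross p (k + 1), Cap k] [Cross (\<not> p) k, Cap (k + 1)]"
| reidemeister1_cup: "local_move [Cup k b, Cross p k] [Cup k (\<not> b)]"
| reidemeister1_cap: "local_move [Cross p k, Cap k] [Cap k]"
| reidemeister2: "local_move [Cross p k, Cross (\<not> p) k] []"
| reidemeister3: "local_move [Cross p k, Cross p (k + 1), Cross p k]
                             [Cross p (k + 1), Cross p k, Cross p (k + 1)]"

inductive move :: "piece list \<Rightarrow> piece list \<Rightarrow> bool" where
  "\<lbrakk>local_move l r; is_diagram (u @ l @ v); is_diagram (u @ r @ v)\<rbrakk>
    \<Longrightarrow> move (u @ l @ v) (u @ r @ v)"

definition isotopic :: "piece list \<Rightarrow> piece list \<Rightarrow> bool" where
  "isotopic w w' \<longleftrightarrow> is_diagram w \<and> is_diagram w' \<and> equivclp move w w'"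

lemma is_diagram_unknot: "is_diagram [Cup 0 True, Cap 0]"
  by (simp add: is_diagram_def)

lemma part_equivp_isotopic: "part_equivp isotopic"
proof (rule part_equivpI)
  show "\<exists>w. isotopic w w"
    using is_diagram_unknot by (auto simp: isotopic_def)
  show "symp isotopic"
    by (rule sympI) (auto simp: isotopic_def intro: equivclp_sym)
  show "transp isotopic"
    by (rule transpI) (auto simp: isotopic_def intro: equivclp_trans)
qed

text \<open>The value \<open>link_of w\<close> is meaningful only if \<open>is_diagram w\<close>.\<close>

quotient_type link = "piece list" / partial: isotopic
  morphisms rep_link link_of
  by (rule part_equivp_isotopic)

lemma link_of_eq_iff:
  "is_diagram w \<Longrightarrow> is_diagram w' \<Longrightarrow> link_of w = link_of w' \<longleftrightarrow> equivclp move w w'"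
  using Quotient3_rel[OF Quotient3_link, of w w'] by (auto simp: isotopic_def)

definition split_link :: "link \<Rightarrow> bool" where
  "split_link L \<longleftrightarrow> (\<exists>w. is_diagram w \<and> link_of w = L \<and> \<not> connected_diagram w)"

definition crossing_number :: "link \<Rightarrow> nat" where
  "crossing_number L = (LEAST c. \<exists>w. is_diagram w \<and> link_of w = L \<and> num_crossings w = c)"


section \<open>The Jones polynomial\<close>

text \<open>
  Finitely supported functions from exponents to integer coefficients, i.e. integer linear
  combinations of powers of \<open>t\<close> with rational exponents; multiplication is convolution.
\<close>

type_synonym tpoly = "rat \<Rightarrow>\<^sub>0 int"

abbreviation t_pow :: "rat \<Rightarrow> tpoly" where
  "t_pow r \<equiv> Poly_Mapping.single r 1"

definition mindeg :: "tpoly \<Rightarrow> rat" where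
  "mindeg f = Min (Poly_Mapping.keys f)"

definition mincf :: "tpoly \<Rightarrow> int" where
  "mincf f = Poly_Mapping.lookup f (mindeg f)"

definition upward_pair :: "piece list \<Rightarrow> nat \<Rightarrow> bool" where
  "upward_pair u k \<longleftrightarrow>
     (\<exists>s. strands u [] = Some s \<and> k + 1 < length s \<and> s ! k \<and> s ! (k + 1))"

text \<open>
  The Jones polynomial is the link invariant determined by its value on the unknot and by the
  skein relation.  It suffices to consider crossings of two strands oriented upwards, since every
  crossing can be turned into this position by a planar isotopy; the smoothing of such a crossing
  along the orientation consists of two vertical strands, that is, the letter is deleted.
\<close>

definition jones_polynomial :: "(link \<Rightarrow> tpoly) \<Rightarrow> bool" where
  "jones_polynomial V \<longleftrightarrow>
     V (link_of [Cup 0 True, Cap 0]) = 1 \<and>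
     (\<forall>u v k. is_diagram (u @ v) \<and> upward_pair u k \<longrightarrow>
        t_pow (- 1) * V (link_of (u @ [Cross True k] @ v))
        - t_pow 1 * V (link_of (u @ [Cross False k] @ v))
        = (t_pow (1 / 2) - t_pow (- 1 / 2)) * V (link_of (u @ v)))"


section \<open>Closed positive braids\<close>

text \<open>
  A positive braid word on \<open>n\<close> strands is a list of indices \<open>i\<close> with \<open>1 \<le> i < n\<close>, where \<open>i\<close> stands
  for the Artin generator \<open>\<sigma>\<^sub>i\<close>.
\<close>

definition positive_braid :: "nat \<Rightarrow> nat list \<Rightarrow> bool" where
  "positive_braid n \<beta> \<longleftrightarrow> n \<ge> 1 \<and> set \<beta> \<subseteq> {1..<n}"

text \<open>
  The braid occupies the positions \<open>0, \<dots>, n - 1\<close> and runs upwards; the \<open>n\<close> closing strands run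
  downwards to the right of it, nested.
\<close>

definition braid_closure :: "nat \<Rightarrow> nat list \<Rightarrow> piece list" where
  "braid_closure n \<beta> =
     map (\<lambda>k. Cup k True) [0..<n] @ map (\<lambda>i. Cross True (i - 1)) \<beta> @ map Cap (rev [0..<n])"

lemma strands_append: "strands (u @ v) s = Option.bind (strands u s) (strands v)"
  by (induction u arbitrary: s) (auto split: bind_split)

lemma strands_braid:
  assumes "set \<beta> \<subseteq> {1..<n}"
  shows "strands (map (\<lambda>i. Cross True (i - 1)) \<beta>) (replicate n True @ replicate n False) =
           Some (replicate n True @ replicate n False)"
  using assms
proof (induction \<beta>)
  case (Cons i \<beta>)
  let ?s = "replicate n True @ replicate n False"
  have i: "1 \<le> i" "i < n" using Cons.prems by auto
  obtain j where j: "i = Suc j" using i by (cases i) auto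
  have "?s ! i = True" "?s ! j = True" using i j by (simp_all add: nth_append)
  moreover have "take j ?s @ ?s ! j # ?s ! i # drop (Suc i) ?s = ?s"
    using i j by (simp add: Cons_nth_drop_Suc del: take_append drop_append)
  ultimately have "attach (Cross True (i - 1)) ?s = Some ?s"
    using i j by (simp del: take_append drop_append)
  with Cons show ?case by (simp del: attach.simps)
qed simp

lemma strands_cups:
  "strands (map (\<lambda>k. Cup k True) [0..<n]) [] = Some (replicate n True @ replicate n False)"
  by (induction n) (auto simp: strands_append replicate_append_same simp flip: replicate_Suc)

lemma strands_caps:
  "strands (map Cap (rev [0..<n])) (replicate n True @ replicate n False) = Some []"
proof (induction n)
  case (Suc n)
  have "attach (Cap n) (replicate (Suc n) True @ replicate (Suc n) False) =
          Some (replicate n True @ replicate n False)"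
    by (auto simp: nth_append simp flip: replicate_append_same[of n True])
  with Suc show ?case by simp
qed simp

lemma is_diagram_braid_closure:
  assumes "positive_braid n \<beta>"
  shows "is_diagram (braid_closure n \<beta>)"
  using assms strands_cups[of n] strands_braid[of \<beta> n] strands_caps[of n]
  by (auto simp: is_diagram_def braid_closure_def positive_braid_def strands_append)

text \<open>
  All crossings of a closed braid involve two strands oriented upwards, so that smoothing the
  \<open>i\<close>-th one according to the orientation means deleting the \<open>i\<close>-th letter of the word.
\<close>

definition reducible_crossing :: "nat \<Rightarrow> nat list \<Rightarrow> nat \<Rightarrow> bool" where
  "reducible_crossing n \<beta> i \<longleftrightarrow>
     \<not> connected_diagram (braid_closure n (take i \<beta> @ drop (i + 1) \<beta>))"

definition reduced_braid :: "nat \<Rightarrow> nat list \<Rightarrow> bool" where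
  "reduced_braid n \<beta> \<longleftrightarrow> (\<forall>i<length \<beta>. \<not> reducible_crossing n \<beta> i)"

end

theory Submission
  imports Defs "HOL-Combinatorics.Cycles"
begin

text \<open>
  For a closed positive braid on \<open>n\<close> strands with \<open>c\<close> crossings, reduced or not and possibly split,
  the lowest term of the Jones polynomial is exactly \<open>(-1)\<^sup>n\<^sup>+\<^sup>c\<^sup>+\<^sup>1 t\<^sup>d\<close> with \<open>d = (c - n + 1) / 2\<close>
  (\<open>lowest_term_closed_positive_braid\<close>).  Divide \<open>V\<close> by this monomial and call the quotient
  \<open>W\<close>; the claim is that \<open>W\<close> has only nonnegative exponents and constant term \<open>1\<close>.
  The skein relation, together with the cancellation of \<open>\<sigma>\<^sub>i\<close> against its inverse, gives

    \<open>W(\<gamma> \<sigma>\<^sub>i \<sigma>\<^sub>i \<delta>) = t W(\<gamma> \<delta>) + (1 - t) W(\<gamma> \<sigma>\<^sub>i \<delta>)\<close>,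

  destabilisation (removing the last strand when \<open>\<sigma>\<^sub>n\<^sub>-\<^sub>1\<close> occurs once) leaves \<open>W\<close> unchanged, and
  removing a split strand divides \<open>W\<close> by \<open>1 + t\<close>.  All three rules respect the claim.  They
  suffice for an induction because every positive word can be transformed by the braid relations
  into a word that contains a square \<open>\<sigma>\<^sub>i \<sigma>\<^sub>i\<close> or contains \<open>\<sigma>\<^sub>n\<^sub>-\<^sub>1\<close> at most once
  (\<open>square_or_top_once\<close>).

  The sign \<open>(-1)\<^sup>n\<^sup>+\<^sup>c\<^sup>+\<^sup>1\<close> depends only on the parity of the number \<open>k\<close> of components, since the components of the closed braid are the cycles
  of the permutation of the braid (\<open>num_components_braid_closure\<close>), whose sign is \<open>(-1)\<^sup>c\<close> as a
  product of \<open>c\<close> transpositions and \<open>(-1)\<^sup>n\<^sup>+\<^sup>k\<close> as a permutation of \<open>n\<close> points with \<open>k\<close> cycles.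

  Finally, the diagram of a non-split link is connected, so every generator occurs in the
  word; it still occurs after the deletion of one letter if the braid is reduced.  So each of the
  \<open>n - 1\<close> generators occurs at least twice, whence \<open>n - 1 \<le> c / 2\<close> and \<open>d \<ge> c / 4\<close>.
\<close>

section \<open>Lowest terms of generalised Laurent polynomials\<close>

text \<open>
  The coefficient \<open>e\<close> may be \<open>0\<close>, and then \<open>d\<close> is merely a strict lower bound for the exponents.  This
  is how terms that do not contribute to the lowest one are discarded in sums.
\<close>

definition has_lowest :: "rat \<Rightarrow> int \<Rightarrow> tpoly \<Rightarrow> bool" where
  "has_lowest d e f \<longleftrightarrow> (\<forall>r<d. Poly_Mapping.lookup f r = 0) \<and> Poly_Mapping.lookup f d = e"

lemma lookup_single_times:
  fixes f :: tpoly
  shows "Poly_Mapping.lookup (Poly_Mapping.single a c * f) r = c * Poly_Mapping.lookup f (r - a)"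
proof -
  have eq: "r = a + q \<longleftrightarrow> q = r - a" for q by auto
  show ?thesis
    by (simp add: lookup_mult prod_fun_def lookup_single when_mult eq)
qed

lemma has_lowest_single_times:
  "has_lowest d e f \<Longrightarrow> has_lowest (a + d) (c * e) (Poly_Mapping.single a c * f)"
  by (auto simp: has_lowest_def lookup_single_times)

lemma has_lowest_below: "has_lowest d e f \<Longrightarrow> d' < d \<Longrightarrow> has_lowest d' 0 f"
  by (auto simp: has_lowest_def)

lemma has_lowest_add:
  "has_lowest d e f \<Longrightarrow> has_lowest d e' g \<Longrightarrow> has_lowest d (e + e') (f + g)"
  by (auto simp: has_lowest_def lookup_add)

lemma has_lowest_diff:
  "has_lowest d e f \<Longrightarrow> has_lowest d e' g \<Longrightarrow> has_lowest d (e - e') (f - g)"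
  by (auto simp: has_lowest_def lookup_minus)

lemma mindeg_eq:
  assumes "has_lowest d e f" "e \<noteq> 0"
  shows "mindeg f = d" "mincf f = e"
proof -
  show *: "mindeg f = d"
    unfolding mindeg_def using assms
    by (intro Min_eqI) (auto simp: has_lowest_def in_keys_iff not_less intro: leI)
  show "mincf f = e"
    using assms * by (simp add: mincf_def has_lowest_def)
qed


section \<open>Positive words up to the braid relations\<close>

inductive braid_step :: "nat list \<Rightarrow> nat list \<Rightarrow> bool" where
  commute: "i + 2 \<le> j \<Longrightarrow> braid_step (u @ [j, i] @ v) (u @ [i, j] @ v)"
| braid: "braid_step (u @ [i, Suc i, i] @ v) (u @ [Suc i, i, Suc i] @ v)"

abbreviation braid_equiv :: "nat list \<Rightarrow> nat list \<Rightarrow> bool" where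
  "braid_equiv \<equiv> equivclp braid_step"

lemma braid_step_context: "braid_step x y \<Longrightarrow> braid_step (u @ x @ v) (u @ y @ v)"
proof (induction rule: braid_step.induct)
  case (commute i j a b)
  show ?case using braid_step.commute[OF commute, of "u @ a" "b @ v"] by simp
next
  case (braid a i b)
  show ?case using braid_step.braid[of "u @ a" i "b @ v"] by simp
qed

lemma braid_equiv_context: "braid_equiv x y \<Longrightarrow> braid_equiv (u @ x @ v) (u @ y @ v)"
proof (induction rule: equivclp_induct)
  case (step y z)
  then show ?case by (blast intro: equivclp_into_equivclp braid_step_context)
qed simp

lemma braid_step_invariants:
  "braid_step x y \<Longrightarrow> set x = set y \<and> length x = length y"
  by (induction rule: braid_step.induct) auto

lemma braid_equiv_invariants:
  "braid_equiv x y \<Longrightarrow> set x = set y \<and> length x = length y"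
proof (induction rule: equivclp_induct)
  case (step y z)
  then show ?case using braid_step_invariants[of y z] braid_step_invariants[of z y] by auto
qed simp

lemma braid_equiv_commute_word:
  "\<forall>i\<in>set u. i + 2 \<le> j \<Longrightarrow> braid_equiv (j # u) (u @ [j])"
proof (induction u)
  case (Cons i u)
  have "braid_equiv ([] @ [j, i] @ u) ([] @ [i, j] @ u)"
    using Cons.prems by (intro r_into_equivclp braid_step.commute) simp
  also have "braid_equiv ([] @ [i, j] @ u) ([i] @ (u @ [j]) @ [])"
    using braid_equiv_context[of "j # u" "u @ [j]" "[i]" "[]"] Cons by simp
  finally show ?case by simp
qed simp

lemma count_list_1_split:
  "count_list xs a = 1 \<Longrightarrow> \<exists>ys zs. xs = ys @ [a] @ zs \<and> a \<notin> set ys \<and> a \<notin> set zs"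
  using count_list_Suc_split_first[of xs a 0] by (auto simp: count_list_0_iff)

text \<open>
  Induction on the highest generator \<open>M\<close> and the number of its occurrences.  The word \<open>w\<close> between two
  consecutive occurrences involves only smaller generators, so by induction it is equivalent to
  a word with a square, in which case nothing is left to do, or to one with at most one \<open>M - 1\<close>.
\<close>

lemma square_or_top_once:
  assumes "set \<beta> \<subseteq> {..m}"
  shows "(\<exists>u i v. braid_equiv \<beta> (u @ [i, i] @ v)) \<or>
         (\<exists>\<beta>'. braid_equiv \<beta> \<beta>' \<and> count_list \<beta>' m \<le> 1)"
  using assms
proof (induction m arbitrary: \<beta> rule: less_induct)
  case (less M)
  note IH_top = less.IH
  show ?case
    using less.prems
  proof (induction "count_list \<beta> M" arbitrary: \<beta> rule: less_induct)
    case less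
    show ?case
    proof (cases "count_list \<beta> M \<le> 1")
      case True
      then show ?thesis by (blast intro: equivclp_refl)
    next
      case False
      then obtain c where c: "count_list \<beta> M = Suc (Suc c)"
        by (metis One_nat_def Suc_le_mono le0 not0_implies_Suc)
      obtain a \<beta>1 where a: "\<beta> = a @ M # \<beta>1" "M \<notin> set a" "count_list \<beta>1 M = Suc c"
        using count_list_Suc_split_first[OF c] by auto
      obtain w b where w: "\<beta>1 = w @ M # b" "M \<notin> set w" "count_list b M = c"
        using count_list_Suc_split_first[OF a(3)] by auto
      have \<beta>: "\<beta> = a @ (M # w @ [M]) @ b" using a w by simp
      have sub: "set w \<subseteq> {..<M}"
        using less.prems w(2) unfolding \<beta> by (auto simp: nat_less_le)
      \<comment> \<open>If no \<open>M - 1\<close> remains between the two letters \<open>M\<close>, they can be brought together.\<close>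
      have *: ?thesis if w': "braid_equiv w w'" "\<forall>i\<in>set w'. i + 2 \<le> M" for w'
      proof -
        have "braid_equiv (a @ (M # w @ [M]) @ b) (a @ [M] @ w' @ [M] @ b)"
          using braid_equiv_context[OF w'(1), of "a @ [M]" "M # b"] by simp
        also have "braid_equiv (a @ [M] @ w' @ [M] @ b) ((a @ w') @ [M, M] @ b)"
          using braid_equiv_context[OF braid_equiv_commute_word[OF w'(2)], of a "M # b"] by simp
        finally show ?thesis unfolding \<beta> by blast
      qed
      show ?thesis
      proof (cases M)
        case 0
        then have "w = []" using sub by simp
        then show ?thesis by (intro *[of w]) auto
      next
        case (Suc m)
        have "set w \<subseteq> {..m}" using sub Suc by auto
        from IH_top[OF _ this] Suc
        consider (square) u i v where "braid_equiv w (u @ [i, i] @ v)"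
          | (once) w' where "braid_equiv w w'" "count_list w' m \<le> 1" by auto
        then show ?thesis
        proof cases
          case square
          from braid_equiv_context[OF this, of "a @ [M]" "M # b"]
          have "braid_equiv \<beta> ((a @ [M] @ u) @ [i, i] @ (v @ M # b))" unfolding \<beta> by simp
          then show ?thesis by blast
        next
          case once
          have sub': "set w' \<subseteq> {..m}"
            using braid_equiv_invariants[OF once(1)] sub Suc by auto
          show ?thesis
          proof (cases "count_list w' m = 0")
            case True
            then have "i \<le> m" "i \<noteq> m" if "i \<in> set w'" for i
              using sub' that by (auto simp: count_list_0_iff)
            then have "\<forall>i\<in>set w'. i + 2 \<le> M"
              using Suc by (fastforce dest: le_neq_implies_less)
            then show ?thesis using *[of w'] once(1) by blast
          next
            case False
            then obtain x y where xy: "w' = x @ [m] @ y" "m \<notin> set x" "m \<notin> set y"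
              using count_list_1_split[of w' m] once(2) by (auto simp: le_Suc_eq)
            have "i \<le> m" "i \<noteq> m" if "i \<in> set x \<union> set y" for i
              using sub' xy that by auto
            then have far: "\<forall>i\<in>set x. i + 2 \<le> M" "\<forall>i\<in>set y. i + 2 \<le> M"
              using Suc by (fastforce dest: le_neq_implies_less)+
            \<comment> \<open>Here \<open>x\<close> and \<open>y\<close> commute with \<open>M\<close>, and \<open>M m M = m M m\<close> saves one letter \<open>M\<close>.\<close>
            let ?\<beta>' = "a @ x @ [m, M, m] @ y @ b"
            have "braid_equiv \<beta> (a @ (M # x @ [m] @ y @ [M]) @ b)"
              using braid_equiv_context[OF once(1), of "a @ [M]" "M # b"] xy(1)
              unfolding \<beta> by simp
            also have "braid_equiv \<dots> (a @ (x @ [M, m] @ y @ [M]) @ b)"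
              using braid_equiv_context[OF braid_equiv_commute_word[OF far(1)], of a "m # y @ M # b"]
              by simp
            also have "braid_equiv \<dots> (a @ (x @ [M, m, M] @ y) @ b)"
              using braid_equiv_context[OF equivclp_sym[OF braid_equiv_commute_word[OF far(2)]],
                of "a @ x @ [M, m]" b] by simp
            also have "braid_equiv \<dots> ?\<beta>'"
              using converse_r_into_equivclp[of braid_step, OF braid_step.braid[of "a @ x" m "y @ b"]] Suc
              by simp
            finally have eq: "braid_equiv \<beta> ?\<beta>'" .
            have "M \<notin> set x" "M \<notin> set y" "m \<noteq> M" using far Suc by auto
            then have "count_list ?\<beta>' M = Suc c"
              using a(2) w(3) by (simp add: count_list_append)
            moreover have "set ?\<beta>' \<subseteq> {..M}"
              using braid_equiv_invariants[OF eq] less.prems by simp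
            ultimately show ?thesis
              using less.hyps[of ?\<beta>'] c equivclp_trans[OF eq] by auto
          qed
        qed
      qed
    qed
  qed
qed


section \<open>Isotopies of closed braids\<close>

lemma link_of_local_move:
  assumes "local_move l r" "is_diagram (u @ l @ v)" "is_diagram (u @ r @ v)"
  shows "link_of (u @ l @ v) = link_of (u @ r @ v)"
  using assms link_of_eq_iff by (blast intro: move.intros r_into_equivclp)

lemma local_move_exchange:
  assumes "pos x + width_in x \<le> pos y" "width_out x = width_in x"
  shows "local_move [y, x] [x, y]"
proof -
  have "shift (pos y) y = y" by (cases y) auto
  then show ?thesis using local_move.far[OF assms(1)] assms by simp
qed

definition cups :: "nat \<Rightarrow> piece list" where
  "cups n = map (\<lambda>k. Cup k True) [0..<n]"

definition caps :: "nat \<Rightarrow> piece list" where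
  "caps n = map Cap (rev [0..<n])"

definition nested_strands :: "nat \<Rightarrow> bool list" where
  "nested_strands n = replicate n True @ replicate n False"

text \<open>
  The crossings of a word between the cups and the caps may have both signs: negative ones occur in
  the skein relation and in the cancellation of a crossing against its inverse.
\<close>

definition crossing_word :: "nat \<Rightarrow> piece list \<Rightarrow> bool" where
  "crossing_word n w \<longleftrightarrow> (\<forall>x\<in>set w. \<exists>p k. x = Cross p k \<and> k + 1 < n)"

definition closed_word :: "nat \<Rightarrow> piece list \<Rightarrow> piece list" where
  "closed_word n w = cups n @ w @ caps n"

lemma cups_Suc: "cups (Suc n) = cups n @ [Cup n True]"
  and caps_Suc: "caps (Suc n) = Cap n # caps n"
  by (simp_all add: cups_def caps_def)

lemma length_nested_strands [simp]: "length (nested_strands n) = 2 * n"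
  by (simp add: nested_strands_def)

lemma nth_nested_strands: "j < 2 * n \<Longrightarrow> nested_strands n ! j = (j < n)"
  by (simp add: nested_strands_def nth_append)

lemma crossing_word_simps [simp]:
  "crossing_word n []"
  "crossing_word n (Cross p k # w) \<longleftrightarrow> k + 1 < n \<and> crossing_word n w"
  "crossing_word n (u @ w) \<longleftrightarrow> crossing_word n u \<and> crossing_word n w"
  by (auto simp: crossing_word_def)

lemma crossing_word_Cons:
  "crossing_word n (x # w) \<longleftrightarrow> (\<exists>p k. x = Cross p k \<and> k + 1 < n) \<and> crossing_word n w"
  by (auto simp: crossing_word_def)

lemma crossing_word_Suc: "crossing_word n w \<Longrightarrow> crossing_word (Suc n) w"
  by (fastforce simp: crossing_word_def)

lemma strands_cups_nested_strands: "strands (cups n) [] = Some (nested_strands n)"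
  using strands_cups by (simp add: cups_def nested_strands_def)

lemma strands_caps_nested_strands: "strands (caps n) (nested_strands n) = Some []"
  using strands_caps by (simp add: caps_def nested_strands_def)

lemma strands_crossing_word: "crossing_word n w \<Longrightarrow> strands w (nested_strands n) = Some (nested_strands n)"
proof (induction w)
  case (Cons x w)
  then obtain p k where x: "x = Cross p k" "k + 1 < n"
    by (auto simp: crossing_word_Cons)
  have "attach x (nested_strands n) = attach (Cross True k) (nested_strands n)" by (simp add: x)
  also have "\<dots> = Some (nested_strands n)"
    using strands_braid[of "[Suc k]" n] x by (simp add: nested_strands_def split: bind_splits)
  finally show ?case using Cons by (simp add: crossing_word_Cons)
qed simp

lemma attach_cup_nested_strands: "attach (Cup n True) (nested_strands n) = Some (nested_strands (Suc n))"
  by (auto simp: nested_strands_def simp flip: replicate_append_same[of n True])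

lemma attach_cap_nested_strands: "attach (Cap n) (nested_strands (Suc n)) = Some (nested_strands n)"
  by (auto simp: nested_strands_def nth_append simp flip: replicate_append_same[of n True])

lemma is_diagram_closed_word:
  assumes "n \<ge> 1" "crossing_word n w"
  shows "is_diagram (closed_word n w)"
proof -
  have "closed_word n w \<noteq> []" using assms(1) by (simp add: closed_word_def cups_def)
  then show ?thesis
    using assms by (simp add: is_diagram_def closed_word_def strands_append strands_cups_nested_strands
      strands_crossing_word strands_caps_nested_strands)
qed

lemma closed_word_move:
  assumes "local_move l r" "n \<ge> 1" "crossing_word n (u @ l @ v)" "crossing_word n (u @ r @ v)"
  shows "link_of (closed_word n (u @ l @ v)) = link_of (closed_word n (u @ r @ v))"
  using link_of_local_move[of l r "cups n @ u" "v @ caps n"] assms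
    is_diagram_closed_word[of n "u @ l @ v"] is_diagram_closed_word[of n "u @ r @ v"]
  by (simp add: closed_word_def)

definition positive_crossings :: "nat list \<Rightarrow> piece list" where
  "positive_crossings \<beta> = map (\<lambda>i. Cross True (i - 1)) \<beta>"

lemma braid_closure_eq: "braid_closure n \<beta> = closed_word n (positive_crossings \<beta>)"
  by (simp add: braid_closure_def closed_word_def positive_crossings_def cups_def caps_def)

lemma positive_crossings_simps [simp]:
  "positive_crossings [] = []"
  "positive_crossings (i # \<beta>) = Cross True (i - 1) # positive_crossings \<beta>"
  "positive_crossings (\<beta> @ \<gamma>) = positive_crossings \<beta> @ positive_crossings \<gamma>"
  by (simp_all add: positive_crossings_def)

lemma crossing_word_positive_crossings:
  assumes "set \<beta> \<subseteq> {1..<n}"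
  shows "crossing_word n (positive_crossings \<beta>)"
  using assms by (auto simp: crossing_word_def positive_crossings_def)

lemma braid_step_link_of:
  assumes "braid_step \<beta> \<gamma>" "n \<ge> 1" "set \<beta> \<subseteq> {1..<n}"
  shows "link_of (braid_closure n \<beta>) = link_of (braid_closure n \<gamma>)"
proof -
  have "set \<gamma> \<subseteq> {1..<n}" using braid_step_invariants assms by blast
  note words = crossing_word_positive_crossings[OF assms(3)] crossing_word_positive_crossings[OF this]
  show ?thesis
    using assms(1)
  proof cases
    case (commute i j u v)
    have "i \<ge> 1" using assms(3) commute by auto
    then have m: "local_move [Cross True (j - 1), Cross True (i - 1)]
                          [Cross True (i - 1), Cross True (j - 1)]"
      using commute(3) by (intro local_move_exchange) auto
    show ?thesis
      using closed_word_move[OF m assms(2), of "positive_crossings u" "positive_crossings v"] words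
      unfolding braid_closure_eq commute(1,2) by simp
  next
    case (braid u i v)
    have "i \<ge> 1" using assms(3) braid by auto
    then have m: "local_move [Cross True (i - 1), Cross True i, Cross True (i - 1)]
                          [Cross True i, Cross True (i - 1), Cross True i]"
      using local_move.reidemeister3[of True "i - 1"] by simp
    show ?thesis
      using closed_word_move[OF m assms(2), of "positive_crossings u" "positive_crossings v"] words
      unfolding braid_closure_eq braid(1,2) by simp
  qed
qed

lemma braid_equiv_link_of:
  assumes "braid_equiv \<beta> \<gamma>" "n \<ge> 1" "set \<beta> \<subseteq> {1..<n}"
  shows "link_of (braid_closure n \<beta>) = link_of (braid_closure n \<gamma>)"
  using assms(1)
proof (induction rule: equivclp_induct)
  case (step y z)
  have "set y \<subseteq> {1..<n}" "set z \<subseteq> {1..<n}"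
    using step.hyps assms(3) braid_equiv_invariants braid_equiv_invariants[OF equivclp_into_equivclp]
    by blast+
  then show ?case using step braid_step_link_of assms(2) by metis
qed simp

text \<open>
  The closure of a braid on \<open>n + 1\<close> strands, seen as a closure on \<open>n\<close> strands with one more
  cup and cap inside, whose heights are variable: the crossings in \<open>a\<close> are below the new cup and those
  in \<open>d\<close> are above the new cap.
\<close>

definition extra_strand :: "nat \<Rightarrow> piece list \<Rightarrow> piece list \<Rightarrow> piece list \<Rightarrow> piece list" where
  "extra_strand n a b d = cups n @ a @ [Cup n True] @ b @ [Cap n] @ d @ caps n"

lemma is_diagram_extra_strand:
  assumes "crossing_word n a" "crossing_word (Suc n) b" "crossing_word n d"
  shows "is_diagram (extra_strand n a b d)"
  using assms
  by (simp add: is_diagram_def extra_strand_def strands_append strands_cups_nested_strands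
    strands_crossing_word strands_caps_nested_strands attach_cup_nested_strands attach_cap_nested_strands
    del: attach.simps)

lemma closed_word_Suc: "closed_word (Suc n) b = extra_strand n [] b []"
  by (simp add: closed_word_def extra_strand_def cups_Suc caps_Suc)

lemma extra_strand_raise_cup:
  assumes "crossing_word n (a @ w @ d)" "crossing_word (Suc n) b"
  shows "link_of (extra_strand n a (w @ b) d) = link_of (extra_strand n (a @ w) b d)"
  using assms
proof (induction w arbitrary: a)
  case (Cons x w)
  obtain p k where x: "x = Cross p k" "k + 1 < n"
    using Cons.prems by (auto simp: crossing_word_Cons)
  have "local_move [Cup n True, x] [x, Cup n True]"
    using x by (intro local_move_exchange) auto
  then have "link_of (extra_strand n a ((x # w) @ b) d) = link_of (extra_strand n (a @ [x]) (w @ b) d)"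
    using link_of_local_move[of "[Cup n True, x]" "[x, Cup n True]" "cups n @ a"
        "w @ b @ [Cap n] @ d @ caps n"]
      is_diagram_extra_strand[of n a "x # w @ b" d] is_diagram_extra_strand[of n "a @ [x]" "w @ b" d]
      Cons.prems x
    by (simp add: extra_strand_def crossing_word_Suc)
  also have "\<dots> = link_of (extra_strand n (a @ x # w) b d)"
    using Cons.IH[of "a @ [x]"] Cons.prems by simp
  finally show ?case .
qed simp

lemma extra_strand_lower_cap:
  assumes "crossing_word n (a @ w @ d)" "crossing_word (Suc n) b"
  shows "link_of (extra_strand n a (b @ w) d) = link_of (extra_strand n a b (w @ d))"
  using assms
proof (induction w arbitrary: d rule: rev_induct)
  case (snoc x w)
  obtain p k where x: "x = Cross p k" "k + 1 < n"
    using snoc.prems by (auto simp: crossing_word_Cons)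
  have "local_move [Cap n, x] [x, Cap n]"
    using x by (intro local_move_exchange) auto
  then have "link_of (extra_strand n a (b @ w @ [x]) d) = link_of (extra_strand n a (b @ w) (x # d))"
    using link_of_local_move[of "[Cap n, x]" "[x, Cap n]" "cups n @ a @ [Cup n True] @ b @ w"
        "d @ caps n"]
      is_diagram_extra_strand[of n a "b @ w @ [x]" d] is_diagram_extra_strand[of n a "b @ w" "x # d"]
      snoc.prems x
    by (simp add: extra_strand_def crossing_word_Suc)
  also have "\<dots> = link_of (extra_strand n a b ((w @ [x]) @ d))"
    using snoc.IH[of "x # d"] snoc.prems x by simp
  finally show ?case .
qed simp

text \<open>
  Markov's destabilisation, when nothing is left between the innermost cup and cap but the crossing
  of the last two strands.  Sliding that strand across the cup turns the crossing into a curl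
  below the cap, and what remains after removing the curl is a zigzag.
\<close>

lemma extra_strand_curl:
  assumes "crossing_word n (a @ d)" "n = Suc k"
  shows "link_of (extra_strand n a [Cross p k] d) = link_of (closed_word n (a @ d))"
proof -
  define u where "u = cups n @ a"
  define v where "v = d @ caps n"
  \<comment> \<open>the orientations above the cup at its new position\<close>
  define s where "s = replicate k True @ [True, False, True] @ replicate n False"
  have u: "strands u [] = Some (nested_strands n)" and v: "strands v (nested_strands n) = Some []"
    using assms by (simp_all add: u_def v_def strands_append strands_cups_nested_strands
      strands_crossing_word strands_caps_nested_strands)
  have nested_strands: "nested_strands n = replicate k True @ [True] @ replicate n False"
    "nested_strands (Suc n) = replicate k True @ [True, True, False] @ replicate n False"
    by (simp_all add: nested_strands_def assms(2) replicate_app_Cons_same)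
  have cup: "attach (Cup k True) (nested_strands n) = Some s"
    by (simp add: s_def nested_strands)
  have cross: "attach (Cross (\<not> p) n) s = Some (nested_strands (Suc n))"
    unfolding s_def nested_strands by (simp add: assms(2) nth_append)
  have cap: "attach (Cap n) s = Some (nested_strands n)"
    unfolding s_def nested_strands by (simp add: assms(2) nth_append)
  note diagram = is_diagram_def strands_append u v cup cross cap attach_cap_nested_strands
  have d: "is_diagram (u @ [Cup n True, Cross p k] @ [Cap n] @ v)"
    using is_diagram_extra_strand[of n a "[Cross p k]" d] assms
    by (simp add: extra_strand_def u_def v_def)
  have d': "is_diagram (u @ [Cup k True, Cross (\<not> p) n] @ [Cap n] @ v)"
    "is_diagram ((u @ [Cup k True]) @ [Cap n] @ v)"
    "is_diagram (u @ [] @ v)"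
    by (simp_all add: diagram del: attach.simps) (simp add: u_def cups_def assms(2))
  have "link_of (extra_strand n a [Cross p k] d) =
          link_of (u @ [Cup n True, Cross p k] @ [Cap n] @ v)"
    by (simp add: extra_strand_def u_def v_def)
  also have "\<dots> = link_of (u @ [Cup k True, Cross (\<not> p) n] @ [Cap n] @ v)"
    using link_of_local_move[OF local_move.slide_cup[of k True "\<not> p"]] d d'(1) assms(2)
    by (metis Suc_eq_plus1)
  also have "\<dots> = link_of ((u @ [Cup k True]) @ [Cap n] @ v)"
    using link_of_local_move[OF local_move.reidemeister1_cap[of "\<not> p" n], of "u @ [Cup k True]" v]
      d' by simp
  also have "\<dots> = link_of (u @ [] @ v)"
    using link_of_local_move[OF local_move.zigzag1[of k True], of u v] d' assms(2) by simp
  finally show ?thesis by (simp add: u_def v_def closed_word_def)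
qed

text \<open>
  The crossings before and after the one to be removed are far from the innermost cup and cap, so
  these can be moved past them until only that crossing is left between them.
\<close>

lemma destabilise:
  assumes "crossing_word n (a @ d)" "n = Suc k"
  shows "link_of (closed_word (Suc n) (a @ [Cross p k] @ d)) = link_of (closed_word n (a @ d))"
proof -
  have "link_of (extra_strand n [] (a @ ([Cross p k] @ d)) []) = link_of (extra_strand n a ([Cross p k] @ d) [])"
    using extra_strand_raise_cup[of n "[]" a "[]" "[Cross p k] @ d"] assms
    by (simp add: crossing_word_Suc)
  also have "\<dots> = link_of (extra_strand n a [Cross p k] d)"
    using extra_strand_lower_cap[of n a d "[]" "[Cross p k]"] assms by simp
  finally show ?thesis using extra_strand_curl[OF assms] closed_word_Suc by simp
qed


section \<open>The lowest term for a closed positive braid\<close>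

lemma upward_pair_braid:
  assumes "crossing_word n w" "k + 1 < n"
  shows "upward_pair (cups n @ w) k"
  using assms by (simp add: upward_pair_def strands_append strands_cups_nested_strands
    strands_crossing_word nth_nested_strands)

lemma skein_closed_word:
  assumes "jones_polynomial V" "crossing_word n (a @ d)" "k + 1 < n"
  shows "t_pow (- 1) * V (link_of (closed_word n (a @ [Cross True k] @ d)))
           - t_pow 1 * V (link_of (closed_word n (a @ [Cross False k] @ d)))
         = (t_pow (1 / 2) - t_pow (- 1 / 2)) * V (link_of (closed_word n (a @ d)))"
proof -
  have "is_diagram ((cups n @ a) @ (d @ caps n))"
    using is_diagram_closed_word[of n "a @ d"] assms by (simp add: closed_word_def)
  moreover have "upward_pair (cups n @ a) k"
    using upward_pair_braid assms by simp
  ultimately show ?thesis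
    using assms(1) unfolding jones_polynomial_def closed_word_def by (metis append.assoc)
qed

text \<open>
  The skein relation at the second of the two crossings: changing it cancels both, smoothing it
  leaves the first one.
\<close>

lemma jones_square:
  assumes "jones_polynomial V" "crossing_word n (a @ d)" "k + 1 < n"
  shows "V (link_of (closed_word n (a @ [Cross True k, Cross True k] @ d))) =
           t_pow 2 * V (link_of (closed_word n (a @ d)))
           + (t_pow (3 / 2) - t_pow (1 / 2)) * V (link_of (closed_word n (a @ [Cross True k] @ d)))"
    (is "?V2 = _ * ?V0 + _ * ?V1")
proof -
  have word: "crossing_word n ((a @ [Cross True k]) @ d)" using assms by simp
  have "link_of (closed_word n (a @ [Cross True k, Cross (\<not> True) k] @ d)) =
          link_of (closed_word n (a @ [] @ d))"
    using assms by (intro closed_word_move local_move.reidemeister2) auto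
  then have "t_pow (- 1) * ?V2 - t_pow 1 * ?V0 = (t_pow (1 / 2) - t_pow (- 1 / 2)) * ?V1"
    using skein_closed_word[OF assms(1) word assms(3)] by simp
  then have "t_pow (- 1) * ?V2 = (t_pow (1 / 2) - t_pow (- 1 / 2)) * ?V1 + t_pow 1 * ?V0"
    by (simp only: diff_eq_eq)
  then have "t_pow 1 * (t_pow (- 1) * ?V2) =
      t_pow 1 * ((t_pow (1 / 2) - t_pow (- 1 / 2)) * ?V1 + t_pow 1 * ?V0)"
    by (rule arg_cong)
  moreover have "t_pow 1 * (t_pow (- 1) * x) = x" "t_pow 1 * (t_pow 1 * x) = t_pow 2 * x"
    "t_pow 1 * ((t_pow (1 / 2) - t_pow (- 1 / 2)) * x) = (t_pow (3 / 2) - t_pow (1 / 2)) * x" for x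
    by (simp_all add: right_diff_distrib mult_single flip: mult.assoc)
  ultimately show ?thesis
    by (simp only: distrib_left add.commute)
qed

text \<open>
  The skein relation for a crossing that joins the last strand to the rest.  With either sign this
  crossing can be removed by destabilisation, so the left-hand side is
  \<open>(t\<^sup>-\<^sup>1 - t) V = -(t\<^sup>1\<^sup>/\<^sup>2 - t\<^sup>-\<^sup>1\<^sup>/\<^sup>2) (t\<^sup>1\<^sup>/\<^sup>2 + t\<^sup>-\<^sup>1\<^sup>/\<^sup>2) V\<close>, and the first factor can be cancelled.
\<close>

lemma jones_split_strand:
  assumes "jones_polynomial V" "crossing_word n w" "n \<ge> 1"
  shows "V (link_of (closed_word (Suc n) w)) =
           - (t_pow (1 / 2) + t_pow (- 1 / 2)) * V (link_of (closed_word n w))" (is "?X = _ * ?Y")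
proof -
  obtain k where k: "n = Suc k" using assms(3) by (cases n) auto
  have "t_pow (- 1) * ?Y - t_pow 1 * ?Y = (t_pow (1 / 2) - t_pow (- 1 / 2)) * ?X"
    using skein_closed_word[OF assms(1), of "Suc n" w "[]" k] destabilise[of n w "[]" k] assms k
    by (simp add: crossing_word_Suc)
  then have "(t_pow (1 / 2) - t_pow (- 1 / 2)) * ?X =
      (t_pow (1 / 2) - t_pow (- 1 / 2)) * (- (t_pow (1 / 2) + t_pow (- 1 / 2)) * ?Y)"
    by (simp add: algebra_simps mult_single flip: mult.assoc)
  moreover have "t_pow (1 / 2) - t_pow (- 1 / 2) \<noteq> 0"
  proof
    assume "t_pow (1 / 2) - t_pow (- 1 / 2) = 0"
    then have "Poly_Mapping.lookup (t_pow (1 / 2) - t_pow (- 1 / 2)) (1 / 2) = 0" by simp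
    then show False by (simp add: lookup_minus lookup_single)
  qed
  ultimately show ?thesis by simp
qed

text \<open>
  The exponent and the sign are those for which each of the three reduction rules has exactly one
  term contributing in the lowest degree: of \<open>t\<^sup>2 V(\<gamma> \<delta>) + (t\<^sup>3\<^sup>/\<^sup>2 - t\<^sup>1\<^sup>/\<^sup>2) V(\<gamma> \<sigma>\<^sub>i \<delta>)\<close> only the
  part with \<open>t\<^sup>1\<^sup>/\<^sup>2\<close>, and of \<open>-(t\<^sup>1\<^sup>/\<^sup>2 + t\<^sup>-\<^sup>1\<^sup>/\<^sup>2) V\<close> only the part with \<open>t\<^sup>-\<^sup>1\<^sup>/\<^sup>2\<close>.  Words with unused
  generators have to be admitted, since \<open>\<gamma> \<delta>\<close> may be such a word.
\<close>

theorem lowest_term_closed_positive_braid: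
  assumes V: "jones_polynomial V" and "positive_braid n \<beta>"
  shows "has_lowest ((of_nat (length \<beta>) - of_nat n + 1) / 2) ((- 1) ^ (n + length \<beta> + 1))
           (V (link_of (braid_closure n \<beta>)))"
  using assms(2)
proof (induction "n + length \<beta>" arbitrary: n \<beta> rule: less_induct)
  case less
  have n: "n \<ge> 1" and \<beta>: "set \<beta> \<subseteq> {1..<n}" using less.prems by (auto simp: positive_braid_def)
  then have "set \<beta> \<subseteq> {..n - 1}" by force
  from square_or_top_once[OF this]
  consider (square) u i v where "braid_equiv \<beta> (u @ [i, i] @ v)"
    | (once) \<gamma> where "braid_equiv \<beta> \<gamma>" "count_list \<gamma> (n - 1) \<le> 1" by blast
  then show ?case
  proof cases
    case square
    note inv = braid_equiv_invariants[OF square]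
    have i: "1 \<le> i" "i < n" and uv: "set (u @ v) \<subseteq> {1..<n}" using inv \<beta> by auto
    define d :: rat where "d = (of_nat (length \<beta>) - of_nat n + 1) / 2"
    define e :: int where "e = (- 1) ^ (n + length \<beta>)"
    let ?V = "\<lambda>\<gamma>. V (link_of (braid_closure n \<gamma>))"
    have len: "length \<beta> = length (u @ v) + 2" using inv by simp
    have "has_lowest ((of_nat (length (u @ v)) - of_nat n + 1) / 2) ((- 1) ^ (n + length (u @ v) + 1))
        (?V (u @ v))"
      using uv n len by (intro less.hyps) (auto simp: positive_braid_def)
    then have "has_lowest (d - 1) (- e) (?V (u @ v))"
      by (simp add: d_def e_def len field_simps)
    then have V0: "has_lowest (2 + (d - 1)) (1 * - e) (t_pow 2 * ?V (u @ v))"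
      by (rule has_lowest_single_times)
    have "has_lowest ((of_nat (length (u @ [i] @ v)) - of_nat n + 1) / 2)
        ((- 1) ^ (n + length (u @ [i] @ v) + 1)) (?V (u @ [i] @ v))"
      using uv i n len by (intro less.hyps) (auto simp: positive_braid_def)
    moreover have "(of_nat (length (u @ [i] @ v)) - of_nat n + 1) / 2 = d - 1 / 2"
      by (simp add: d_def len field_simps)
    moreover have "(- 1) ^ (n + length (u @ [i] @ v) + 1) = e"
      by (simp add: e_def len)
    ultimately have V1: "has_lowest (d - 1 / 2) e (?V (u @ [i] @ v))"
      by (simp only:)
    have "has_lowest d (0 + (0 - 1 * e))
        (t_pow 2 * ?V (u @ v) + (t_pow (3 / 2) * ?V (u @ [i] @ v) - t_pow (1 / 2) * ?V (u @ [i] @ v)))"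
    proof (intro has_lowest_add has_lowest_diff)
      show "has_lowest d 0 (t_pow 2 * ?V (u @ v))"
        using V0 by (rule has_lowest_below) simp
      show "has_lowest d 0 (t_pow (3 / 2) * ?V (u @ [i] @ v))"
        using has_lowest_single_times[OF V1, of "3 / 2" 1] by (rule has_lowest_below) simp
      show "has_lowest d (1 * e) (t_pow (1 / 2) * ?V (u @ [i] @ v))"
        using has_lowest_single_times[OF V1, of "1 / 2" 1] by simp
    qed
    also have "t_pow 2 * ?V (u @ v) + (t_pow (3 / 2) * ?V (u @ [i] @ v) - t_pow (1 / 2) * ?V (u @ [i] @ v))
        = ?V (u @ [i, i] @ v)"
      using jones_square[OF V, of n "positive_crossings u" "positive_crossings v" "i - 1"]
        crossing_word_positive_crossings[OF uv] i
      by (simp add: braid_closure_eq algebra_simps)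
    also have "\<dots> = ?V \<beta>"
      using braid_equiv_link_of[OF square n \<beta>] by simp
    finally show ?thesis by (simp add: d_def e_def)
  next
    case once
    note inv = braid_equiv_invariants[OF once(1)]
    have \<gamma>: "set \<gamma> \<subseteq> {1..<n}" using inv \<beta> by simp
    have link: "link_of (braid_closure n \<beta>) = link_of (braid_closure n \<gamma>)"
      using braid_equiv_link_of[OF once(1) n \<beta>] .
    show ?thesis
    proof (cases "n = 1")
      case True
      then have "\<beta> = []" using \<beta> by simp
      then show ?thesis
        using V True unfolding jones_polynomial_def braid_closure_def
        by (simp add: has_lowest_def lookup_one when_def)
    next
      case False
      then have "n = Suc (Suc (n - 2))" using n by simp
      then obtain k where k: "n = Suc (Suc k)" by blast
      let ?m = "Suc k"
      consider (none) "?m \<notin> set \<gamma>" | (one) "count_list \<gamma> ?m = 1"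
        using once(2) k by (fastforce simp: count_list_0_iff le_Suc_eq)
      then show ?thesis
      proof cases
        case none
        then have \<gamma>': "set \<gamma> \<subseteq> {1..<?m}" using \<gamma> k by (fastforce simp: less_Suc_eq)
        define d :: rat where "d = (of_nat (length \<beta>) - of_nat n + 1) / 2"
        define e :: int where "e = (- 1) ^ (n + length \<beta>)"
        let ?Y = "V (link_of (braid_closure ?m \<gamma>))"
        have "has_lowest ((of_nat (length \<gamma>) - of_nat ?m + 1) / 2) ((- 1) ^ (?m + length \<gamma> + 1)) ?Y"
          using \<gamma>' inv k by (intro less.hyps) (auto simp: positive_braid_def)
        then have Y: "has_lowest (d + 1 / 2) e ?Y"
          using inv by (simp add: d_def e_def k field_simps)
        have "has_lowest d (0 + - 1 * e)
            (Poly_Mapping.single (1 / 2) (- 1) * ?Y + Poly_Mapping.single (- 1 / 2) (- 1) * ?Y)"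
        proof (intro has_lowest_add)
          show "has_lowest d 0 (Poly_Mapping.single (1 / 2) (- 1) * ?Y)"
            using has_lowest_single_times[OF Y] by (rule has_lowest_below) simp
          show "has_lowest d (- 1 * e) (Poly_Mapping.single (- 1 / 2) (- 1) * ?Y)"
            using has_lowest_single_times[OF Y, of "- 1 / 2" "- 1"] by simp
        qed
        also have "Poly_Mapping.single (1 / 2) (- 1) * ?Y + Poly_Mapping.single (- 1 / 2) (- 1) * ?Y
            = V (link_of (braid_closure n \<gamma>))"
          using jones_split_strand[OF V crossing_word_positive_crossings[OF \<gamma>']] k
          by (simp add: braid_closure_eq algebra_simps single_uminus)
        finally show ?thesis by (simp add: link d_def e_def)
      next
        case one
        then obtain u v where uv: "\<gamma> = u @ [?m] @ v" "?m \<notin> set u" "?m \<notin> set v"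
          using count_list_1_split by metis
        have uv': "set (u @ v) \<subseteq> {1..<?m}"
          using \<gamma> uv k by (fastforce simp: less_Suc_eq)
        have "has_lowest ((of_nat (length (u @ v)) - of_nat ?m + 1) / 2)
            ((- 1) ^ (?m + length (u @ v) + 1)) (V (link_of (braid_closure ?m (u @ v))))"
          using uv uv' inv k by (intro less.hyps) (auto simp: positive_braid_def)
        moreover have "link_of (braid_closure n \<gamma>) = link_of (braid_closure ?m (u @ v))"
          using destabilise[of ?m "positive_crossings u" "positive_crossings v" k]
            crossing_word_positive_crossings[OF uv'] k uv(1)
          by (simp add: braid_closure_eq)
        moreover have "length \<beta> = Suc (length (u @ v))" using inv uv by simp
        ultimately show ?thesis using link by (simp add: k)
      qed
    qed
  qed
qed

section \<open>Cycles of a permutation and its sign\<close>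

text \<open>
  Classes of the equivalence generated by \<open>a \<mapsto> p a\<close> rather than iterates of \<open>p\<close>, so that they
  can be compared directly with the components of a diagram, which are generated by arcs.
\<close>

definition orbits :: "('a \<Rightarrow> 'a) \<Rightarrow> 'a set \<Rightarrow> 'a set set" where
  "orbits p A = (\<lambda>x. Collect (equivclp (\<lambda>a b. b = p a) x)) ` A"

lemma equivclp_same_class: "Collect (equivclp r x) = Collect (equivclp r y) \<longleftrightarrow> equivclp r x y"
  by (auto intro: equivclp_trans equivclp_sym)

lemma equivclp_graph_agree:
  assumes "equivclp (\<lambda>a b. b = p a) x y" "x \<in> A" "p permutes A" "\<And>a. a \<in> A \<Longrightarrow> q a = p a"
  shows "equivclp (\<lambda>a b. b = q a) x y \<and> y \<in> A"
  using assms(1)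
proof (induction rule: equivclp_induct)
  case (step y z)
  have y: "y \<in> A" using step by simp
  have z: "z \<in> A" using step.hyps(2) y permutes_in_image[OF assms(3)] by metis
  have "z = q y \<or> y = q z" using step.hyps(2) assms(4) y z by auto
  then show ?case using step.IH z by (blast intro: equivclp_into_equivclp)
qed (simp add: assms(2))

text \<open>
  Since \<open>q\<close> is injective and maps \<open>A\<close> onto \<open>A\<close>, no class of \<open>q\<close> can leave \<open>A\<close>, not even backwards.
\<close>

lemma orbits_agree:
  assumes "p permutes A" "inj q" "\<And>a. a \<in> A \<Longrightarrow> q a = p a"
  shows "orbits q A = orbits p A"
proof -
  have q: "equivclp (\<lambda>a b. b = q a) x y \<and> y \<in> A" if "equivclp (\<lambda>a b. b = p a) x y" "x \<in> A" for x y
    using equivclp_graph_agree[OF that assms(1,3)] .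
  have p: "equivclp (\<lambda>a b. b = p a) x y" if xy: "equivclp (\<lambda>a b. b = q a) x y" and "x \<in> A" for x y
  proof -
    have "equivclp (\<lambda>a b. b = p a) x y \<and> y \<in> A"
      using xy
    proof (induction rule: equivclp_induct)
      case (step y z)
      have y: "y \<in> A" using step by simp
      have z: "z \<in> A"
        using step.hyps(2)
      proof
        assume "z = q y"
        then show ?thesis using assms(3)[OF y] permutes_in_image[OF assms(1)] y by simp
      next
        assume "y = q z"
        moreover obtain a where "a \<in> A" "y = p a" using permutes_image[OF assms(1)] y by blast
        ultimately have "z = a" using assms(2,3) by (metis injD)
        then show ?thesis using \<open>a \<in> A\<close> by simp
      qed
      then have "z = p y \<or> y = p z" using step.hyps(2) assms(3) y by metis
      then show ?case using step.IH z by (blast intro: equivclp_into_equivclp)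
    qed (simp add: that(2))
    then show ?thesis by simp
  qed
  show ?thesis
    unfolding orbits_def using p q by (intro image_cong) auto
qed

lemma sign_cycle_of_list:
  assumes "cycle (c # cs)"
  shows "sign (cycle_of_list (c # cs)) = (- 1) ^ length cs"
  using assms
proof (induction cs arbitrary: c)
  case (Cons d cs)
  have "sign (cycle_of_list (c # d # cs)) = sign (transpose c d) * sign (cycle_of_list (d # cs))"
    unfolding cycle_of_list.simps(1)
    by (intro sign_compose permutation_swap_id permutation_of_cycle)
  then show ?case using Cons by (simp add: sign_swap_id del: cycle_of_list.simps)
qed simp

lemma orbits_cycle_of_list:
  assumes "cycle (c # cs)"
  shows "orbits (cycle_of_list (c # cs)) (set (c # cs)) = {set (c # cs)}"
proof -
  let ?cs = "c # cs" and ?q = "cycle_of_list (c # cs)"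
  let ?R = "equivclp (\<lambda>a b. b = ?q a)"
  have rot: "map ?q ?cs = rotate1 ?cs"
    using cyclic_rotation[OF assms, of 1] by simp
  have "?R c (?cs ! i)" if "i < length ?cs" for i
    using that
  proof (induction i)
    case (Suc i)
    have "?q (?cs ! i) = rotate1 ?cs ! i" using rot Suc.prems by (metis Suc_lessD nth_map)
    also have "\<dots> = ?cs ! Suc i" using Suc.prems by (simp add: nth_append)
    finally have "?cs ! Suc i = ?q (?cs ! i)" ..
    moreover have "?R c (?cs ! i)" using Suc by simp
    ultimately show ?case by (blast intro: equivclp_into_equivclp)
  qed simp
  then have R: "?R c y" if "y \<in> set ?cs" for y using that by (metis in_set_conv_nth)
  have "y \<in> set ?cs" if "?R c y" for y
    using equivclp_graph_agree[OF that _ cycle_permutes[of ?cs]] by simp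
  then have "Collect (?R c) = set ?cs" using R by blast
  moreover have "Collect (?R y) = Collect (?R c)" if "y \<in> set ?cs" for y
    using R[OF that] equivclp_same_class equivclp_sym by metis
  ultimately have "orbits ?q (set ?cs) = (\<lambda>_. set ?cs) ` set ?cs"
    unfolding orbits_def by (intro image_cong) metis+
  then show ?thesis by (simp add: image_constant_conv)
qed

text \<open>
  A cycle of length \<open>l\<close> has sign \<open>(-1)\<^sup>l\<^sup>-\<^sup>1\<close>, so the exponents of all cycles add up to the number of
  points minus the number of orbits, fixed points being cycles of length \<open>1\<close>.
\<close>

lemma sign_orbits:
  assumes "p permutes A" "finite A"
  shows "sign p = (- 1) ^ (card A + card (orbits p A))"
proof -
  have "cycle_decomp A p" using cycle_decomposition assms by blast
  then have "finite A \<and> p permutes A \<and> sign p = (- 1) ^ (card A + card (orbits p A))"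
  proof (induction rule: cycle_decomp.induct)
    case empty
    then show ?case by (simp add: orbits_def fun_eq_iff)
  next
    case (comp I p cs)
    show ?case
    proof (cases cs)
      case Nil
      then show ?thesis using comp by simp
    next
      case (Cons c ds)
      let ?q = "cycle_of_list cs"
      have q: "?q permutes set cs" by (rule cycle_permutes)
      have I: "finite I" "p permutes I" "sign p = (- 1) ^ (card I + card (orbits p I))"
        using comp by auto
      have perm: "?q \<circ> p permutes set cs \<union> I"
        using permutes_compose[OF permutes_subset[OF I(2)] permutes_subset[OF q]] by blast
      have agree_q: "(?q \<circ> p) a = ?q a" if "a \<in> set cs" for a
      proof -
        have "a \<notin> I" using that comp.hyps by blast
        then show ?thesis using permutes_not_in[OF I(2)] by simp
      qed
      have agree_p: "(?q \<circ> p) a = p a" if "a \<in> I" for a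
      proof -
        have "p a \<notin> set cs" using that comp.hyps permutes_in_image[OF I(2)] by blast
        then show ?thesis using permutes_not_in[OF q] by simp
      qed
      have orb_I: "orbits (?q \<circ> p) I = orbits p I"
        using orbits_agree[OF I(2) permutes_inj[OF perm] agree_p] by blast
      have "orbits (?q \<circ> p) (set cs) = orbits ?q (set cs)"
        by (rule orbits_agree[OF q permutes_inj[OF perm] agree_q])
      also have "\<dots> = {set cs}"
        using orbits_cycle_of_list[of c ds] Cons comp.hyps by simp
      finally have orb_cs: "orbits (?q \<circ> p) (set cs) = {set cs}" .
      have "orbits (?q \<circ> p) (set cs \<union> I) = insert (set cs) (orbits p I)"
        using orb_I orb_cs unfolding orbits_def by (simp add: image_Un)
      moreover have "set cs \<notin> orbits p I"
      proof
        assume "set cs \<in> orbits p I"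
        then obtain x where "x \<in> I" "set cs = Collect (equivclp (\<lambda>a b. b = p a) x)"
          by (auto simp: orbits_def)
        then have "x \<in> set cs" by simp
        then show False using \<open>x \<in> I\<close> comp by auto
      qed
      ultimately have card_orb: "card (orbits (?q \<circ> p) (set cs \<union> I)) = Suc (card (orbits p I))"
        using I(1) by (simp add: orbits_def)
      have card: "card (set cs \<union> I) = Suc (length ds) + card I"
        using comp Cons I(1) by (subst card_Un_disjoint) (auto simp: distinct_card)
      have "permutation p" using I permutation_permutes by blast
      then have "sign (?q \<circ> p) = (- 1) ^ length ds * (- 1) ^ (card I + card (orbits p I))"
        using sign_compose permutation_of_cycle sign_cycle_of_list[of c ds] comp Cons I(3) by metis
      then have "sign (?q \<circ> p) = (- 1) ^ (card (set cs \<union> I) + card (orbits (?q \<circ> p) (set cs \<union> I)))"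
        unfolding card card_orb by (simp only:) (simp add: power_add)
      then show ?thesis using perm I(1) by blast
    qed
  qed
  then show ?thesis by simp
qed

section \<open>Components of a closed braid\<close>

text \<open>
  At every height, as many strands run upwards on the left as run downwards on the right; this is
  their number above the first \<open>m\<close> letters of the closure of a word of length \<open>c\<close> on \<open>n\<close> strands.
\<close>

definition half_width :: "nat \<Rightarrow> nat \<Rightarrow> nat \<Rightarrow> nat" where
  "half_width n c m = (if m \<le> n + c then min n m else 2 * n + c - m)"

lemma length_braid_closure: "length (braid_closure n \<beta>) = 2 * n + length \<beta>"
  by (simp add: braid_closure_def)

lemma braid_closure_nth:
  "m < n \<Longrightarrow> braid_closure n \<beta> ! m = Cup m True"
  "l < length \<beta> \<Longrightarrow> braid_closure n \<beta> ! (n + l) = Cross True (\<beta> ! l - 1)"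
  "l < n \<Longrightarrow> braid_closure n \<beta> ! (n + length \<beta> + l) = Cap (n - 1 - l)"
  by (simp_all add: braid_closure_def nth_append rev_nth)

lemma braid_closure_index_cases:
  fixes m n c :: nat
  assumes "m < 2 * n + c"
  obtains (cup) "m < n" | (cross) l where "m = n + l" "l < c" | (cap) l where "m = n + c + l" "l < n"
proof (cases "m < n")
  case True
  then show ?thesis by (rule cup)
next
  case m: False
  show ?thesis
  proof (cases "m < n + c")
    case True
    then show ?thesis using m by (intro cross[of "m - n"]) auto
  next
    case False
    then show ?thesis using assms by (intro cap[of "m - (n + c)"]) auto
  qed
qed

lemma half_width_simps:
  "m \<le> n \<Longrightarrow> half_width n c m = m"
  "l \<le> c \<Longrightarrow> half_width n c (n + l) = n"
  "half_width n c (n + c + l) = n - l"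
  by (auto simp: half_width_def)

lemma strands_take_braid_closure:
  assumes "set \<beta> \<subseteq> {1..<n}" "m \<le> 2 * n + length \<beta>"
  shows "strands (take m (braid_closure n \<beta>)) [] = Some (nested_strands (half_width n (length \<beta>) m))"
  using assms(2)
proof (induction m)
  case 0
  then show ?case by (simp add: half_width_simps nested_strands_def)
next
  case (Suc m)
  let ?w = "braid_closure n \<beta>" and ?h = "half_width n (length \<beta>)"
  have m: "m < 2 * n + length \<beta>" using Suc.prems by simp
  have "attach (?w ! m) (nested_strands (?h m)) = Some (nested_strands (?h (Suc m)))"
    using m
  proof (cases rule: braid_closure_index_cases)
    case cup
    then show ?thesis
      using attach_cup_nested_strands[of m] by (simp add: half_width_simps braid_closure_nth del: attach.simps)
  next
    case (cross l)
    have "\<beta> ! l \<in> {1..<n}" using cross(2) assms(1) nth_mem by blast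
    then have "strands [?w ! m] (nested_strands n) = Some (nested_strands n)"
      using cross by (intro strands_crossing_word) (auto simp: braid_closure_nth)
    then show ?thesis
      using cross half_width_simps(2)[of "Suc l" "length \<beta>" n]
      by (simp add: half_width_simps del: attach.simps split: bind_splits)
  next
    case (cap l)
    have "n - l = Suc (n - 1 - l)" using cap by simp
    then show ?thesis
      using attach_cap_nested_strands[of "n - 1 - l"] half_width_simps(3)[of n "length \<beta>" "Suc l"] cap
      by (simp add: half_width_simps braid_closure_nth del: attach.simps)
  qed
  then show ?case
    using Suc m by (simp add: take_Suc_conv_app_nth length_braid_closure strands_append
      del: attach.simps)
qed

lemma points_braid_closure:
  assumes "set \<beta> \<subseteq> {1..<n}"
  shows "points (braid_closure n \<beta>) =
    {(m, j). m \<le> 2 * n + length \<beta> \<and> j < 2 * half_width n (length \<beta>) m}"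
proof -
  have "(m \<le> 2 * n + length \<beta> \<and> j < length (the (strands (take m (braid_closure n \<beta>)) []))) =
      (m \<le> 2 * n + length \<beta> \<and> j < 2 * half_width n (length \<beta>) m)" for m j
  proof (cases "m \<le> 2 * n + length \<beta>")
    case True
    then show ?thesis using strands_take_braid_closure[OF assms True] by simp
  qed simp
  then show ?thesis by (simp only: points_def length_braid_closure)
qed

text \<open>
  Spreads a labelling \<open>g l j\<close> of the braid strands (position \<open>j\<close>, after \<open>l\<close> crossings) over all points
  of the closed braid: each closing strand gets the label of the bottom end with which it forms a
  nested circle, and the strands below and above the braid are vertical.  For positions to
  the right of the diagram, to which the arcs of \<open>arc.right\<close> extend, the truncated subtraction
  yields the constant label \<open>g 0 0\<close>.
\<close>

definition label :: "(nat \<Rightarrow> nat \<Rightarrow> 'a) \<Rightarrow> nat \<Rightarrow> nat \<Rightarrow> nat \<times> nat \<Rightarrow> 'a" where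
  "label g n c = (\<lambda>(m, j). let h = half_width n c m in
     if j < h then g (if m \<le> n + c then m - n else c) j else g 0 (2 * h - 1 - j))"

lemma label_simps:
  "m \<le> n \<Longrightarrow> label g n c (m, j) = (if j < m then g 0 j else g 0 (2 * m - 1 - j))"
  "l \<le> c \<Longrightarrow> label g n c (n + l, j) = (if j < n then g l j else g 0 (2 * n - 1 - j))"
  "label g n c (n + c + l, j) = (if j < n - l then g c j else g 0 (2 * (n - l) - 1 - j))"
  by (auto simp: label_def half_width_def)

text \<open>
  A labelling of the braid strands that is transported along the crossings, and for which both ends of
  each closing strand agree, is constant along the link.  It is used to separate components
  (labels are orbits of the permutation) and to separate pieces of the diagram (labels tell on
  which side of an unused generator a strand lies).
\<close>

lemma arc_same_label:
  assumes \<beta>: "set \<beta> \<subseteq> {1..<n}"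
    and closed: "\<And>j. j < n \<Longrightarrow> g (length \<beta>) j = g 0 j"
    and step: "\<And>l j. l < length \<beta> \<Longrightarrow> j < n
      \<Longrightarrow> g (Suc l) j = g l (transpose (\<beta> ! l - 1) (\<beta> ! l) j)"
    and arc: "arc (braid_closure n \<beta>) x y"
  shows "label g n (length \<beta>) x = label g n (length \<beta>) y"
proof -
  let ?w = "braid_closure n \<beta>" and ?c = "length \<beta>"
  let ?L = "label g n ?c"
  have L: "?L (m, j) = (if j < m then g 0 j else g 0 (2 * m - 1 - j))"
    "?L (Suc m, j) = (if j < Suc m then g 0 j else g 0 (2 * m + 1 - j))" if "m < n" for m j
    using that label_simps(1)[of m n g ?c] label_simps(1)[of "Suc m" n g ?c] by auto
  have L': "?L (n + l, j) = (if j < n then g l j else g 0 (2 * n - 1 - j))"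
    "?L (Suc (n + l), j) = (if j < n then g (Suc l) j else g 0 (2 * n - 1 - j))" if "l < ?c" for l j
    using that label_simps(2)[of l ?c g n] label_simps(2)[of "Suc l" ?c g n] by auto
  have L'': "?L (n + ?c + l, j) = (if j < n - l then g ?c j else g 0 (2 * (n - l) - 1 - j))"
    "?L (Suc (n + ?c + l), j) =
       (if j < n - Suc l then g ?c j else g 0 (2 * (n - Suc l) - 1 - j))" for l j
    using label_simps(3)[of g n ?c] label_simps(3)[of g n ?c "Suc l"] by auto
  have range: "1 \<le> \<beta> ! l" "\<beta> ! l < n" if "l < ?c" for l
    using \<beta> that nth_mem by force+
  note index = braid_closure_index_cases[of _ n ?c]
  show ?thesis
    using arc
  proof cases
    case (left m j)
    from left(3) have "m < 2 * n + ?c" by (simp add: length_braid_closure)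
    then show ?thesis
    proof (cases rule: index)
      case (cross l)
      then have "j < \<beta> ! l - 1" using left(4) by (simp add: braid_closure_nth)
      then have "transpose (\<beta> ! l - 1) (\<beta> ! l) j = j" "j < n"
        using range[OF cross(2)] by (auto simp: transpose_def)
      then show ?thesis using left cross step[of l j] by (simp add: L')
    qed (use left in \<open>auto simp: L L'' braid_closure_nth\<close>)
  next
    case (right m j)
    from right(3) have "m < 2 * n + ?c" by (simp add: length_braid_closure)
    then show ?thesis
    proof (cases rule: index)
      case cup
      then show ?thesis using right by (auto simp: L braid_closure_nth)
    next
      case (cross l)
      then have "\<beta> ! l \<le> Suc j" using right(4) by (simp add: braid_closure_nth)
      then have "transpose (\<beta> ! l - 1) (\<beta> ! l) (Suc (Suc j)) = Suc (Suc j)"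
        by (auto simp: transpose_def)
      then show ?thesis
        using right cross step[of l "Suc (Suc j)"] by (simp add: L' braid_closure_nth)
    next
      case (cap l)
      then have "n - Suc l \<le> j" using right(4) by (simp add: braid_closure_nth)
      moreover have "2 * (n - l) - 1 - (j + 2) = 2 * (n - Suc l) - 1 - j"
        "\<not> j + 2 < n - l" "\<not> j < n - Suc l" using cap calculation by auto
      ultimately show ?thesis using right cap by (simp add: L'' braid_closure_nth)
    qed
  next
    case (cup m k b)
    from cup(3) have "m < 2 * n + ?c" by (simp add: length_braid_closure)
    then show ?thesis
      by (cases rule: index) (use cup in \<open>auto simp: L braid_closure_nth\<close>)
  next
    case (cap m k)
    from cap(3) have "m < 2 * n + ?c" by (simp add: length_braid_closure)
    then show ?thesis
    proof (cases rule: index)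
      case (cap l)
      then have "k = n - 1 - l" using \<open>?w ! m = Cap k\<close> by (simp add: braid_closure_nth)
      moreover from this have "2 * (n - l) - 1 - (k + 1) = k" "k < n - l" "\<not> k + 1 < n - l" "k < n"
        using cap by auto
      ultimately show ?thesis using closed[of k] cap \<open>x = _\<close> \<open>y = _\<close> by (simp add: L'')
    qed (use cap in \<open>auto simp: braid_closure_nth\<close>)
  next
    case (rising m p k)
    from rising(3) have "m < 2 * n + ?c" by (simp add: length_braid_closure)
    then show ?thesis
    proof (cases rule: index)
      case (cross l)
      then have k: "\<beta> ! l = Suc k" using rising(4) range[of l] by (auto simp: braid_closure_nth)
      then show ?thesis
        using rising cross range[OF cross(2)] step[of l "Suc k"] by (simp add: L')
    qed (use rising in \<open>auto simp: braid_closure_nth\<close>)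
  next
    case (falling m p k)
    from falling(3) have "m < 2 * n + ?c" by (simp add: length_braid_closure)
    then show ?thesis
    proof (cases rule: index)
      case (cross l)
      then have k: "\<beta> ! l = Suc k" using falling(4) range[of l] by (auto simp: braid_closure_nth)
      then show ?thesis
        using falling cross range[OF cross(2)] step[of l k] by (simp add: L')
    qed (use falling in \<open>auto simp: braid_closure_nth\<close>)
  qed
qed

text \<open>
  Maps the position of a strand at the top of the braid to its position at the bottom.
\<close>

fun braid_perm :: "nat list \<Rightarrow> nat \<Rightarrow> nat" where
  "braid_perm [] = id"
| "braid_perm (i # \<beta>) = transpose (i - 1) i \<circ> braid_perm \<beta>"

lemma braid_perm_append: "braid_perm (\<beta> @ \<gamma>) = braid_perm \<beta> \<circ> braid_perm \<gamma>"
  by (induction \<beta>) (simp_all add: comp_assoc)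

lemma braid_perm_take_Suc:
  "l < length \<beta> \<Longrightarrow>
    braid_perm (take (Suc l) \<beta>) j = braid_perm (take l \<beta>) (transpose (\<beta> ! l - 1) (\<beta> ! l) j)"
  by (simp add: take_Suc_conv_app_nth braid_perm_append)

lemma braid_perm_permutes: "set \<beta> \<subseteq> {1..<n} \<Longrightarrow> braid_perm \<beta> permutes {..<n}"
proof (induction \<beta>)
  case (Cons i \<beta>)
  then have "transpose (i - 1) i permutes {..<n}" by (intro permutes_swap_id) auto
  with Cons show ?case by (auto intro: permutes_compose simp del: o_apply)
qed (simp add: permutes_id)

lemma sign_braid_perm: "set \<beta> \<subseteq> {1..<n} \<Longrightarrow> sign (braid_perm \<beta>) = (- 1) ^ length \<beta>"
proof (induction \<beta>)
  case (Cons i \<beta>)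
  then have "braid_perm \<beta> permutes {..<n}" by (intro braid_perm_permutes) simp
  then have "permutation (braid_perm \<beta>)" by (rule permutes_imp_permutation[rotated]) simp
  then have "sign (braid_perm (i # \<beta>)) = sign (transpose (i - 1) i) * sign (braid_perm \<beta>)"
    by (simp only: braid_perm.simps sign_compose permutation_swap_id)
  moreover have "i - 1 \<noteq> i" using Cons.prems by auto
  ultimately show ?case using Cons by (simp add: sign_swap_id del: braid_perm.simps)
qed simp


lemma braid_strand_connected:
  fixes \<beta> :: "nat list" and n :: nat
  defines "w \<equiv> braid_closure n \<beta>"
  assumes \<beta>: "set \<beta> \<subseteq> {1..<n}" and "l \<le> length \<beta>" "j < n"
  shows "equivclp (arc w) (n + l, j) (n, braid_perm (take l \<beta>) j)"
  using assms(3,4)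
proof (induction l arbitrary: j)
  case (Suc l)
  then have l: "l < length \<beta>" by simp
  then have "\<beta> ! l \<in> {1..<n}" using \<beta> nth_mem by blast
  then obtain k where k: "\<beta> ! l = Suc k" "Suc k < n" by (cases "\<beta> ! l") auto
  have letter: "n + l < length w" "w ! (n + l) = Cross True k"
    using l k by (simp_all add: w_def length_braid_closure braid_closure_nth)
  let ?j = "transpose k (Suc k) j"
  have "arc w (n + l, ?j) (n + Suc l, j)"
  proof -
    have "j < k \<or> j = k \<or> j = Suc k \<or> j = (j - 2) + 2 \<and> k \<le> j - 2" by linarith
    then consider "j < k" | "j = k" | "j = Suc k" | i where "j = i + 2" "k \<le> i" by blast
    then show ?thesis
    proof cases
      case 1
      then show ?thesis using arc.left[of "n + l" w j] letter by (simp add: transpose_def)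
    next
      case 2
      then show ?thesis using arc.falling[OF letter] by simp
    next
      case 3
      then show ?thesis using arc.rising[OF letter] by simp
    next
      case (4 i)
      then show ?thesis using arc.right[of "n + l" w i] letter by (simp add: transpose_def)
    qed
  qed
  then have "equivclp (arc w) (n + Suc l, j) (n + l, ?j)" by blast
  also have "equivclp (arc w) (n + l, ?j) (n, braid_perm (take l \<beta>) ?j)"
    using Suc.prems k by (intro Suc.IH) (auto simp: transpose_def)
  finally show ?case using braid_perm_take_Suc[OF l, of j] k by simp
qed simp

text \<open>
  Below and above the braid the strands are vertical, but those on the right shift by two positions with
  every cup and cap; in terms of \<open>j\<close>, the distance to the outermost strand, they do not move.
\<close>

lemma closing_strands_connected:
  fixes \<beta> :: "nat list" and n :: nat
  defines "w \<equiv> braid_closure n \<beta>" and "c \<equiv> length \<beta>"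
  shows "\<lbrakk>j < m; m \<le> n\<rbrakk> \<Longrightarrow> equivclp (arc w) (m, j) (n, j)"
    and "\<lbrakk>j < m; m \<le> n\<rbrakk> \<Longrightarrow> equivclp (arc w) (m, 2 * m - 1 - j) (n, 2 * n - 1 - j)"
    and "\<lbrakk>l \<le> c; n \<le> j; set \<beta> \<subseteq> {1..<n}\<rbrakk> \<Longrightarrow> equivclp (arc w) (n + l, j) (n, j)"
    and "j < n - l \<Longrightarrow> equivclp (arc w) (n + c + l, j) (n + c, j)"
    and "j < n - l \<Longrightarrow> equivclp (arc w) (n + c + l, 2 * (n - l) - 1 - j) (n + c, 2 * n - 1 - j)"
proof -
  have cup: "m < length w" "w ! m = Cup m True" if "m < n" for m
    using that by (simp_all add: w_def length_braid_closure braid_closure_nth)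
  have cap: "n + c + l < length w" "w ! (n + c + l) = Cap (n - 1 - l)" if "l < n" for l
    using that by (simp_all add: w_def c_def length_braid_closure braid_closure_nth)
  show "equivclp (arc w) (m, j) (n, j)" if "j < m" "m \<le> n"
    using that(2,1)
  proof (induction m rule: inc_induct)
    case (step m)
    then have "arc w (m, j) (m + 1, j)" using cup[of m] by (intro arc.left) auto
    then have "equivclp (arc w) (m, j) (Suc m, j)" by auto
    also have "equivclp (arc w) \<dots> (n, j)" using step by simp
    finally show ?case .
  qed simp
  show "equivclp (arc w) (m, 2 * m - 1 - j) (n, 2 * n - 1 - j)" if "j < m" "m \<le> n"
    using that(2,1)
  proof (induction m rule: inc_induct)
    case (step m)
    then have "arc w (m, (2 * m - 1 - j) + 0) (m + 1, (2 * m - 1 - j) + 2)"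
      using cup[of m] arc.right[of m w "2 * m - 1 - j"] by simp
    moreover have "2 * m - 1 - j + 2 = 2 * Suc m - 1 - j" using step by simp
    ultimately have "arc w (m, 2 * m - 1 - j) (Suc m, 2 * Suc m - 1 - j)" by simp
    then have "equivclp (arc w) (m, 2 * m - 1 - j) (Suc m, 2 * Suc m - 1 - j)"
      by (rule r_into_equivclp)
    also have "equivclp (arc w) \<dots> (n, 2 * n - 1 - j)" using step by simp
    finally show ?case .
  qed simp
  show "equivclp (arc w) (n + l, j) (n, j)" if "l \<le> c" "n \<le> j" "set \<beta> \<subseteq> {1..<n}"
    using that(1)
  proof (induction l)
    case (Suc l)
    then have "l < length \<beta>" by (simp add: c_def)
    then have "\<beta> ! l \<in> {1..<n}" using that(3) nth_mem by blast
    then have j: "\<beta> ! l - 1 \<le> j - 2" "(j - 2) + 2 = j" using that(2) by auto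
    have "arc w (n + l, (j - 2) + 2) (n + l + 1, (j - 2) + 2)"
      using arc.right[of "n + l" w "j - 2"] j(1) Suc.prems
      by (simp add: w_def c_def length_braid_closure braid_closure_nth)
    then have "arc w (n + l, j) (n + Suc l, j)" unfolding j(2) by simp
    then have "equivclp (arc w) (n + Suc l, j) (n + l, j)" by (rule converse_r_into_equivclp)
    also have "equivclp (arc w) (n + l, j) (n, j)" using Suc by simp
    finally show ?case .
  qed simp
  show "equivclp (arc w) (n + c + l, j) (n + c, j)" if "j < n - l"
    using that
  proof (induction l)
    case (Suc l)
    then have "arc w (n + c + l, j) (n + c + l + 1, j)" using cap[of l] by (intro arc.left) auto
    then have "equivclp (arc w) (n + c + Suc l, j) (n + c + l, j)" by auto
    also have "equivclp (arc w) \<dots> (n + c, j)" using Suc by (intro Suc.IH) simp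
    finally show ?case .
  qed simp
  show "equivclp (arc w) (n + c + l, 2 * (n - l) - 1 - j) (n + c, 2 * n - 1 - j)" if "j < n - l"
    using that
  proof (induction l)
    case (Suc l)
    have "2 * (n - Suc l) - 1 - j + 2 = 2 * (n - l) - 1 - j" using Suc.prems by auto
    moreover have "n - 1 - l \<le> 2 * (n - Suc l) - 1 - j" using Suc.prems by auto
    ultimately have "arc w (n + c + l, 2 * (n - l) - 1 - j) (n + c + l + 1, 2 * (n - Suc l) - 1 - j)"
      using cap[of l] arc.right[of "n + c + l" w "2 * (n - Suc l) - 1 - j"] Suc.prems by simp
    then have "equivclp (arc w) (n + c + Suc l, 2 * (n - Suc l) - 1 - j)
        (n + c + l, 2 * (n - l) - 1 - j)" by auto
    also have "equivclp (arc w) \<dots> (n + c, 2 * n - 1 - j)" using Suc by (intro Suc.IH) simp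
    finally show ?case .
  qed simp
qed

text \<open>
  Follows the link downwards to the bottom of the braid, or around the nested circle if the point
  lies on a downward strand.
\<close>

definition bottom_index :: "nat \<Rightarrow> nat list \<Rightarrow> nat \<times> nat \<Rightarrow> nat" where
  "bottom_index n \<beta> = label (\<lambda>l. braid_perm (take l \<beta>)) n (length \<beta>)"

lemma bottom_connected:
  fixes \<beta> :: "nat list" and n :: nat
  defines "w \<equiv> braid_closure n \<beta>"
  assumes \<beta>: "set \<beta> \<subseteq> {1..<n}" and x: "x \<in> points w"
  shows "equivclp (arc w) x (n, bottom_index n \<beta> x)" and "bottom_index n \<beta> x < n"
proof -
  let ?c = "length \<beta>" and ?R = "equivclp (arc w)"
  note strands = braid_strand_connected[OF \<beta>, folded w_def]
  note outside = closing_strands_connected[where \<beta> = \<beta> and n = n, folded w_def]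
  have circle: "?R (n, 2 * n - 1 - j) (n, j)" if "j < n" for j
  proof -
    have "arc w (j + 1, j) (j + 1, j + 1)"
      using that by (intro arc.cup[of j w j True])
        (simp_all add: w_def length_braid_closure braid_closure_nth)
    moreover have "?R (j + 1, j) (n, j)" using outside(1)[of j "j + 1"] that by simp
    moreover have "?R (j + 1, j + 1) (n, 2 * n - 1 - j)" using outside(2)[of j "j + 1"] that by simp
    ultimately show ?thesis by (meson equivclp_sym equivclp_trans r_into_equivclp)
  qed
  have in_range: "braid_perm (take l \<beta>) j < n" if "j < n" for l j
  proof -
    have "set (take l \<beta>) \<subseteq> {1..<n}" using \<beta> set_take_subset by fast
    from permutes_in_image[OF braid_perm_permutes[OF this], of j] that show ?thesis by simp
  qed
  obtain m j where mj: "x = (m, j)" "m \<le> 2 * n + ?c" "j < 2 * half_width n ?c m"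
    using x points_braid_closure[OF \<beta>] by (auto simp: w_def)
  consider "m \<le> n" | l where "m = n + l" "l \<le> ?c" | l where "m = n + ?c + l" "l \<le> n"
  proof -
    have "m \<le> n \<or> (m = n + (m - n) \<and> m - n \<le> ?c) \<or>
        (m = n + ?c + (m - (n + ?c)) \<and> m - (n + ?c) \<le> n)"
      using mj(2) by linarith
    then show ?thesis using that by blast
  qed
  then have "?R x (n, bottom_index n \<beta> x) \<and> bottom_index n \<beta> x < n"
  proof cases
    case 1
    then have "j < 2 * m" using mj(3) by (simp add: half_width_simps)
    show ?thesis
    proof (cases "j < m")
      case True
      then show ?thesis
        using 1 outside(1)[of j m] by (simp add: mj(1) bottom_index_def label_simps)
    next
      case False
      define i where "i = 2 * m - 1 - j"
      have i: "i < m" "j = 2 * m - 1 - i" using \<open>j < 2 * m\<close> False by (auto simp: i_def)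
      have "?R (m, j) (n, 2 * n - 1 - i)" using outside(2)[of i m] i 1 by simp
      also have "?R \<dots> (n, i)" using circle[of i] i 1 by simp
      finally show ?thesis
        using i False 1 by (simp add: mj(1) bottom_index_def label_simps flip: i_def)
    qed
  next
    case (2 l)
    then have "j < 2 * n" using mj(3) by (simp add: half_width_simps)
    then show ?thesis
      using 2 strands[of l j] outside(3)[of l j] circle[of "2 * n - 1 - j"] in_range[of j l] \<beta>
      by (auto simp: mj(1) bottom_index_def label_simps intro: equivclp_trans)
  next
    case (3 l)
    then have j: "j < 2 * (n - l)" using mj(3) by (simp add: half_width_simps)
    show ?thesis
    proof (cases "j < n - l")
      case True
      then show ?thesis
        using 3 outside(4)[of j l] strands[of ?c j] in_range[of j ?c]
        by (auto simp: mj(1) bottom_index_def label_simps intro: equivclp_trans)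
    next
      case False
      define i where "i = 2 * (n - l) - 1 - j"
      have i: "i < n - l" "j = 2 * (n - l) - 1 - i" using j False by (auto simp: i_def)
      have "?R (m, j) (n + ?c, 2 * n - 1 - i)" using outside(5)[of i l] i 3 by simp
      also have "?R \<dots> (n, 2 * n - 1 - i)" using outside(3)[of ?c "2 * n - 1 - i"] \<beta> i by simp
      also have "?R \<dots> (n, i)" using circle[of i] i by simp
      finally show ?thesis
        using i False 3 by (simp add: mj(1) bottom_index_def label_simps flip: i_def)
    qed
  qed
  then show "equivclp (arc w) x (n, bottom_index n \<beta> x)" "bottom_index n \<beta> x < n" by auto
qed

lemma closure_joins_braid_ends:
  fixes \<beta> :: "nat list" and n :: nat
  defines "w \<equiv> braid_closure n \<beta>"
  assumes \<beta>: "set \<beta> \<subseteq> {1..<n}" and j: "j < n"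
  shows "equivclp (arc w) (n, j) (n, braid_perm \<beta> j)"
proof -
  let ?c = "length \<beta>" and ?R = "equivclp (arc w)"
  define l where "l = n - 1 - j"
  note outside = closing_strands_connected[where \<beta> = \<beta> and n = n, folded w_def]
  have l: "l < n" "n - l = Suc j" "n - 1 - l = j" using j by (auto simp: l_def)
  have "arc w (n + ?c + l, j) (n + ?c + l, j + 1)"
    using l by (intro arc.cap) (simp_all add: w_def length_braid_closure braid_closure_nth)
  then have cap: "?R (n + ?c + l, Suc j) (n + ?c + l, j)" by auto
  have "?R (n + ?c, 2 * n - 1 - j) (n + ?c + l, Suc j)"
    using outside(5)[of j l] l by (simp add: equivclp_sym)
  also note cap
  also have "?R (n + ?c + l, j) (n + ?c, j)" using outside(4)[of j l] l by simp
  also have "?R \<dots> (n, braid_perm \<beta> j)"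
    using braid_strand_connected[OF \<beta>, of ?c j] j by (simp add: w_def)
  finally have top: "?R (n + ?c, 2 * n - 1 - j) (n, braid_perm \<beta> j)" .
  let ?p = "(n, 2 * n - 1 - j)"
  have "?p \<in> points w" using j by (simp add: w_def points_braid_closure[OF \<beta>] half_width_simps)
  from bottom_connected(1)[OF \<beta> this[unfolded w_def]]
  moreover have "bottom_index n \<beta> ?p = j"
    using j by (auto simp: bottom_index_def label_simps)
  ultimately have "?R ?p (n, j)" by (simp add: w_def)
  then have "?R (n, j) ?p" by (rule equivclp_sym)
  also have "?R ?p (n + ?c, 2 * n - 1 - j)"
    using outside(3)[of ?c "2 * n - 1 - j"] \<beta> j by (simp add: equivclp_sym)
  also note top
  finally show ?thesis .
qed

lemma card_quotient_kernel:
  assumes "\<And>x y. x \<in> A \<Longrightarrow> y \<in> A \<Longrightarrow> R x y \<longleftrightarrow> f x = f y"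
  shows "card (A // {(x, y). x \<in> A \<and> y \<in> A \<and> R x y}) = card (f ` A)"
proof -
  have "A // {(x, y). x \<in> A \<and> y \<in> A \<and> R x y} = (\<lambda>z. {y \<in> A. f y = z}) ` (f ` A)"
  proof -
    have "{(x, y). x \<in> A \<and> y \<in> A \<and> R x y} `` {x} = {y \<in> A. f y = f x}" if "x \<in> A" for x
      using that by (auto simp: assms)
    then show ?thesis by (simp add: quotient_def image_image UNION_singleton_eq_range)
  qed
  moreover have "inj_on (\<lambda>z. {y \<in> A. f y = z}) (f ` A)"
    by (rule inj_onI) auto
  ultimately show ?thesis by (simp add: card_image)
qed

text \<open>
  Every point lies on the component of a bottom end of the braid, and the closing strands join the
  bottom ends \<open>j\<close> and \<open>\<pi> j\<close>.  There are no further identifications, since labelling each strand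
  with the orbit of its bottom end is consistent.
\<close>

lemma num_components_braid_closure:
  assumes \<beta>: "set \<beta> \<subseteq> {1..<n}"
  shows "num_components (braid_closure n \<beta>) = card (orbits (braid_perm \<beta>) {..<n})"
proof -
  let ?w = "braid_closure n \<beta>" and ?\<pi> = "braid_perm \<beta>" and ?c = "length \<beta>"
  define cl where "cl = (\<lambda>a. Collect (equivclp (\<lambda>a b. b = ?\<pi> a) a))"
  define f where "f = (\<lambda>x. cl (bottom_index n \<beta> x))"
  have cl_perm: "cl (?\<pi> a) = cl a" for a
    unfolding cl_def equivclp_same_class by auto
  have f_label: "f = label (\<lambda>l j. cl (braid_perm (take l \<beta>) j)) n ?c"
    by (auto simp: f_def bottom_index_def label_def fun_eq_iff Let_def)
  have f_arc: "f x = f y" if "arc ?w x y" for x y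
    unfolding f_label using that
    by (intro arc_same_label[OF \<beta>]) (simp_all add: cl_perm braid_perm_take_Suc)
  have f_eq: "f x = f y" if "equivclp (arc ?w) x y" for x y
    using that by (induction rule: equivclp_induct) (auto dest: f_arc)
  have cl_eq: "equivclp (arc ?w) (n, a) (n, b)" if "cl a = cl b" "a < n" for a b
  proof -
    have "equivclp (\<lambda>a b. b = ?\<pi> a) a b" using that by (simp add: cl_def equivclp_same_class)
    then have "b < n \<and> equivclp (arc ?w) (n, a) (n, b)"
    proof (induction rule: equivclp_induct)
      case (step y z)
      have "y < n" using step by simp
      then have z: "z < n"
        using step.hyps(2) permutes_in_image[OF braid_perm_permutes[OF \<beta>]] by auto
      have "equivclp (arc ?w) (n, y) (n, z)"
        using step.hyps(2) closure_joins_braid_ends[OF \<beta>] \<open>y < n\<close> z by (auto intro: equivclp_sym)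
      then show ?case using step.IH z by (blast intro: equivclp_trans)
    qed (simp add: that(2))
    then show ?thesis by simp
  qed
  have "equivclp (arc ?w) x y \<longleftrightarrow> f x = f y" if xy: "x \<in> points ?w" "y \<in> points ?w" for x y
  proof
    assume "f x = f y"
    then have "equivclp (arc ?w) (n, bottom_index n \<beta> x) (n, bottom_index n \<beta> y)"
      unfolding f_def by (rule cl_eq) (rule bottom_connected(2)[OF \<beta> xy(1)])
    then show "equivclp (arc ?w) x y"
      using bottom_connected(1)[OF \<beta>] xy by (meson equivclp_sym equivclp_trans)
  qed (rule f_eq)
  then have "num_components ?w = card (f ` points ?w)"
    unfolding num_components_def same_component_def by (rule card_quotient_kernel)
  also have "f ` points ?w = cl ` (bottom_index n \<beta> ` points ?w)"
    by (simp add: f_def image_image)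
  also have "bottom_index n \<beta> ` points ?w = {..<n}"
  proof (intro equalityI subsetI)
    fix j assume "j \<in> {..<n}"
    then have "(n, j) \<in> points ?w" "bottom_index n \<beta> (n, j) = j"
      by (simp_all add: points_braid_closure[OF \<beta>] half_width_simps bottom_index_def label_simps)
    then show "j \<in> bottom_index n \<beta> ` points ?w" by force
  qed (use bottom_connected(2)[OF \<beta>] in auto)
  finally show ?thesis by (simp add: cl_def orbits_def)
qed

corollary parity_num_components:
  assumes "set \<beta> \<subseteq> {1..<n}"
  shows "(- 1 :: int) ^ (n + num_components (braid_closure n \<beta>)) = (- 1) ^ length \<beta>"
  using sign_orbits[OF braid_perm_permutes[OF assms]] sign_braid_perm[OF assms]
  by (simp add: num_components_braid_closure[OF assms])


section \<open>Reduced words\<close>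

text \<open>
  If \<open>i\<close> is missing, then no crossing exchanges strands at positions below \<open>i\<close> with others, so a point at
  height \<open>n\<close> and position \<open>0\<close> cannot be connected to one at position \<open>i\<close>.
\<close>

lemma generators_occur_if_connected:
  assumes \<beta>: "set \<beta> \<subseteq> {1..<n}" and conn: "connected_diagram (braid_closure n \<beta>)"
    and i: "1 \<le> i" "i < n"
  shows "i \<in> set \<beta>"
proof (rule ccontr)
  assume i_notin: "i \<notin> set \<beta>"
  let ?w = "braid_closure n \<beta>" and ?c = "length \<beta>"
  let ?L = "label (\<lambda>l j. j < i) n ?c"
  have arc: "?L x = ?L y" if "arc ?w x y" for x y
  proof (rule arc_same_label[OF \<beta> _ _ that])
    fix l j
    assume "l < ?c"
    then have "\<beta> ! l \<noteq> i" using i_notin nth_mem by metis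
    then show "(j < i) = (transpose (\<beta> ! l - 1) (\<beta> ! l) j < i)"
      by (auto simp: transpose_def)
  qed simp
  have meet: "?L x = ?L y" if "meet ?w x y" for x y
    using that
  proof cases
    case (1 m p k)
    from 1(3) have "m < 2 * n + ?c" by (simp add: length_braid_closure)
    then show ?thesis
    proof (cases rule: braid_closure_index_cases)
      case (cross l)
      have \<beta>l: "\<beta> ! l \<in> {1..<n}" "\<beta> ! l \<noteq> i" using cross(2) \<beta> i_notin nth_mem by blast+
      then show ?thesis using 1 cross by (auto simp: braid_closure_nth label_simps)
    qed (use 1 in \<open>auto simp: braid_closure_nth\<close>)
  qed
  have "?L x = ?L y" if "equivclp (sup (arc ?w) (meet ?w)) x y" for x y
    using that by (induction rule: equivclp_induct) (auto dest: arc meet)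
  moreover have "(n, 0) \<in> points ?w" "(n, i) \<in> points ?w"
    using i by (simp_all add: points_braid_closure[OF \<beta>] half_width_simps)
  ultimately have "?L (n, 0) = ?L (n, i)" using conn unfolding connected_diagram_def by blast
  then show False using i by (simp add: label_simps)
qed

text \<open>
  Deleting one occurrence of a generator leaves a connected diagram, in which it must occur again.
\<close>

lemma reduced_braid_length:
  assumes \<beta>: "set \<beta> \<subseteq> {1..<n}" and conn: "connected_diagram (braid_closure n \<beta>)"
    and red: "reduced_braid n \<beta>"
  shows "2 * (n - 1) \<le> length \<beta>"
proof -
  have "2 \<le> count_list \<beta> i" if i: "i \<in> {1..<n}" for i
  proof -
    have "i \<in> set \<beta>" using generators_occur_if_connected[OF \<beta> conn] i by simp
    then obtain p where p: "p < length \<beta>" "\<beta> ! p = i" by (auto simp: in_set_conv_nth)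
    let ?\<gamma> = "take p \<beta> @ drop (p + 1) \<beta>"
    have "connected_diagram (braid_closure n ?\<gamma>)"
      using red p(1) by (simp add: reduced_braid_def reducible_crossing_def)
    moreover have "set ?\<gamma> \<subseteq> {1..<n}"
      using \<beta> set_take_subset[of p \<beta>] set_drop_subset[of "p + 1" \<beta>] by auto
    ultimately have "i \<in> set ?\<gamma>" using generators_occur_if_connected[of ?\<gamma> n i] i by simp
    then have "1 \<le> count_list ?\<gamma> i" by (metis One_nat_def Suc_leI count_list_0_iff neq0_conv)
    moreover have "\<beta> = take p \<beta> @ i # drop (p + 1) \<beta>"
      using id_take_nth_drop[OF p(1)] p(2) by simp
    from arg_cong[OF this, of "\<lambda>\<gamma>. count_list \<gamma> i"]
    have "count_list \<beta> i = Suc (count_list ?\<gamma> i)" by simp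
    ultimately show ?thesis by simp
  qed
  then have "(\<Sum>i\<in>{1..<n}. 2) \<le> sum (count_list \<beta>) {1..<n}" by (intro sum_mono) simp
  also have "\<dots> = length \<beta>" using sum_count_set[OF \<beta>] by simp
  finally show ?thesis by simp
qed


section \<open>The Jones polynomial of a reduced positive braid\<close>

theorem theorem8p1:
  fixes V :: "link \<Rightarrow> tpoly" and L :: link and n c k :: nat and \<beta> :: "nat list"
  assumes "jones_polynomial V"
    and "positive_braid n \<beta>"
    and "reduced_braid n \<beta>"
    and "length \<beta> = c"
    and "L = link_of (braid_closure n \<beta>)"
    and "\<not> split_link L"
    and "num_components (braid_closure n \<beta>) = k"
  shows "mindeg (V L) \<ge> of_nat c / 4 - (of_nat k - 1) / 2
       \<and> (of_nat c / 4 - (of_nat k - 1) / 2 :: rat) \<ge> of_nat (crossing_number L) / 4 - (of_nat k - 1) / 2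
       \<and> mincf (V L) = (- 1) ^ (k - 1)"
proof -
  let ?w = "braid_closure n \<beta>" and ?d = "(of_nat c - of_nat n + 1) / 2 :: rat"
  have n: "n \<ge> 1" and \<beta>: "set \<beta> \<subseteq> {1..<n}" using assms(2) by (auto simp: positive_braid_def)
  have diagram: "is_diagram ?w" using is_diagram_braid_closure assms(2) .
  then have conn: "connected_diagram ?w" using assms(5,6) by (auto simp: split_link_def)
  have "has_lowest ?d ((- 1) ^ (n + c + 1)) (V L)"
    using lowest_term_closed_positive_braid[OF assms(1,2)] assms(4,5) by simp
  then have low: "mindeg (V L) = ?d" "mincf (V L) = (- 1) ^ (n + c + 1)"
    using mindeg_eq by fastforce+
  have "(- 1 :: int) ^ (n + k) = (- 1) ^ c"
    using parity_num_components[OF \<beta>] assms(4,7) by simp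
  moreover have k: "k \<ge> 1"
  proof -
    have "0 \<in> {..<n}" using n by simp
    then have "orbits (braid_perm \<beta>) {..<n} \<noteq> {}" unfolding orbits_def by blast
    then have "card (orbits (braid_perm \<beta>) {..<n}) > 0"
      by (simp add: card_gt_0_iff orbits_def)
    then show ?thesis using num_components_braid_closure[OF \<beta>] assms(7) by simp
  qed
  ultimately have "(- 1 :: int) ^ (n + c + 1) = (- 1) ^ (k - 1)"
    by (cases k) (auto simp: minus_one_power_iff split: if_splits)
  moreover have "2 * (n - 1) \<le> c"
    using reduced_braid_length[OF \<beta> conn assms(3)] assms(4) by simp
  then have "of_nat (2 * (n - 1)) \<le> (of_nat c :: rat)" by (rule of_nat_mono)
  then have "2 * of_nat n - 2 \<le> (of_nat c :: rat)" using n by (simp add: of_nat_diff)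
  moreover have "(1 :: rat) \<le> of_nat k" using k by simp
  moreover have "crossing_number L \<le> c"
  proof -
    have "num_crossings ?w = c"
    proof -
      have "\<exists>p :: bool. p" by blast
      then show ?thesis
        using assms(4) by (simp add: num_crossings_def braid_closure_def filter_map comp_def)
    qed
    then show ?thesis
      unfolding crossing_number_def using diagram assms(5) by (intro Least_le) blast
  qed
  then have "(of_nat (crossing_number L) :: rat) \<le> of_nat c" by simp
  ultimately show ?thesis using low by (simp add: field_simps)
qed

end
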